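(* Let $E$ and $F$ be Banach spaces (both real or both complex), $k$ a positive integer, and $P\in\mathcal{P}(^kE,F)$. Then $P$ is unconditionally converging in each of the following cases: (a) $P$ is completely continuous at $0$, i.e. $P\in\mathcal{P}_{cc0}(^kE,F)$; (b) $P$ takes Rosenthal subsets of $E$ into relatively compact subsets of $F$; (c) $P\in\mathcal{P}_{wd}(^kE,F)$; (d) $P$ is weakly compact, i.e. $P\in\mathcal{P}_{wco}(^kE,F)$.
   Context: $\mathcal{P}(^kE,F)$ is the space of continuous $k$-homogeneous polynomials from $E$ to $F$. A series $\sum x_i$ in a Banach space $E$ is weakly unconditionally Cauchy (w.u.C.) if $\sum_i|f(x_i)|<\infty$ for every $f\in E^*$; it is unconditionally converging (u.c.) if every subseries is norm convergent. $P\in\mathcal{P}(^kE,F)$ is unconditionally converging if $\sum P(x_i)$ is u.c. whenever $\sum x_i$ is a w.u.C. series in $E$. $\mathcal{P}_{cc0}(^kE,F)$: those $P\in\mathcal{P}(^kE,F)$ taking weakly null sequences into norm null sequences. A set $A\subset E$ is a Rosenthal set if every sequence in $A$ has a weakly Cauchy subsequence. A set $A\subset E$ is a Dunford-Pettis set if for every weakly null sequence $(f_n)\subset E^*$ one has $\lim_n\sup_{x\in A}|f_n(x)|=0$. $\mathcal{P}_{wd}(^kE,F)$: those $P\in\mathcal{P}(^kE,F)$ whose restriction to each Dunford-Pettis subset of $E$, endowed with the inherited weak topology, is continuous (into $F$ with the norm topology). $\mathcal{P}_{wco}(^kE,F)$: those $P\in\mathcal{P}(^kE,F)$ taking bounded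 subsets of $E$ into relatively weakly compact subsets of $F$. *)

theory Defs
  imports "HOL-Analysis.Analysis"
begin

text \<open>Scalars: a class whose members are exactly the real field and the complex field (up to
  isometric isomorphism), so that one statement covers the real and the complex case.\<close>

class real_or_complex = real_normed_field +
  assumes real_or_complex:
    "(\<forall>z::'a. \<exists>a. z = a *\<^sub>R 1) \<or>
     (\<exists>i::'a. i * i = - 1 \<and>
        (\<forall>z. \<exists>a b. z = a *\<^sub>R 1 + b *\<^sub>R i \<and> norm z = sqrt (a\<^sup>2 + b\<^sup>2)))"

instance real :: real_or_complex
  by standard simp

instance complex :: real_or_complex
proof
  have "z = Re z *\<^sub>R 1 + Im z *\<^sub>R \<i> \<and> norm z = sqrt ((Re z)\<^sup>2 + (Im z)\<^sup>2)" for z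
    by (simp add: complex_eq_iff cmod_def)
  then show "(\<forall>z::complex. \<exists>a. z = a *\<^sub>R 1) \<or>
     (\<exists>i::complex. i * i = - 1 \<and>
        (\<forall>z. \<exists>a b. z = a *\<^sub>R 1 + b *\<^sub>R i \<and> norm z = sqrt (a\<^sup>2 + b\<^sup>2)))"
    by (metis i_squared)
qed

text \<open>A Banach space over the scalar field \<open>'k\<close>: the class \<open>banach\<close> supplies the complete norm
  and the underlying real structure, \<open>scale\<close> is the multiplication by scalars of \<open>'k\<close>.\<close>

locale banach_space_over = vector_space scale
  for scale :: "'k::real_or_complex \<Rightarrow> 'a::banach \<Rightarrow> 'a" +
  assumes norm_scale: "norm (scale c x) = norm c * norm x"
    and scale_of_real: "scale (of_real r) x = r *\<^sub>R x"

lemma banach_space_over_scaleR: "banach_space_over (scaleR :: real \<Rightarrow> 'a::banach \<Rightarrow> 'a)"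
  by unfold_locales (simp_all add: algebra_simps)

lemma banach_space_over_complex: "banach_space_over ((*) :: complex \<Rightarrow> complex \<Rightarrow> complex)"
  by unfold_locales (simp_all add: algebra_simps norm_mult scaleR_conv_of_real)

text \<open>The dual \<open>E\<^sup>*\<close> is a set of functions, with pointwise operations and the norm \<open>onorm\<close>;
  elements of the bidual are therefore only constrained on \<open>E\<^sup>*\<close>.\<close>

definition dual :: "('k::real_or_complex \<Rightarrow> 'e::banach \<Rightarrow> 'e) \<Rightarrow> ('e \<Rightarrow> 'k) set" where
  "dual sE = {f. Vector_Spaces.linear sE (*) f \<and> continuous_on UNIV f}"

definition bidual :: "('k::real_or_complex \<Rightarrow> 'e::banach \<Rightarrow> 'e) \<Rightarrow> (('e \<Rightarrow> 'k) \<Rightarrow> 'k) set" where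
  "bidual sE = {\<phi>.
     (\<forall>f\<in>dual sE. \<forall>g\<in>dual sE. \<phi> (\<lambda>x. f x + g x) = \<phi> f + \<phi> g) \<and>
     (\<forall>c. \<forall>f\<in>dual sE. \<phi> (\<lambda>x. c * f x) = c * \<phi> f) \<and>
     (\<exists>C. \<forall>f\<in>dual sE. norm (\<phi> f) \<le> C * onorm f)}"

definition weak_topology :: "('k::real_or_complex \<Rightarrow> 'e::banach \<Rightarrow> 'e) \<Rightarrow> 'e topology" where
  "weak_topology sE = topology_generated_by {f -` U | f U. f \<in> dual sE \<and> open U}"

definition weakly_null :: "('k::real_or_complex \<Rightarrow> 'e::banach \<Rightarrow> 'e) \<Rightarrow> (nat \<Rightarrow> 'e) \<Rightarrow> bool" where
  "weakly_null sE x \<longleftrightarrow> (\<forall>f\<in>dual sE. (\<lambda>n. f (x n)) \<longlonglongrightarrow> 0)"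

definition weakly_Cauchy :: "('k::real_or_complex \<Rightarrow> 'e::banach \<Rightarrow> 'e) \<Rightarrow> (nat \<Rightarrow> 'e) \<Rightarrow> bool" where
  "weakly_Cauchy sE x \<longleftrightarrow> (\<forall>f\<in>dual sE. Cauchy (\<lambda>n. f (x n)))"

definition weakly_null_dual ::
    "('k::real_or_complex \<Rightarrow> 'e::banach \<Rightarrow> 'e) \<Rightarrow> (nat \<Rightarrow> 'e \<Rightarrow> 'k) \<Rightarrow> bool" where
  "weakly_null_dual sE f \<longleftrightarrow>
     (\<forall>n. f n \<in> dual sE) \<and> (\<forall>\<phi>\<in>bidual sE. (\<lambda>n. \<phi> (f n)) \<longlonglongrightarrow> 0)"

definition wuC :: "('k::real_or_complex \<Rightarrow> 'e::banach \<Rightarrow> 'e) \<Rightarrow> (nat \<Rightarrow> 'e) \<Rightarrow> bool" where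
  "wuC sE x \<longleftrightarrow> (\<forall>f\<in>dual sE. summable (\<lambda>i. norm (f (x i))))"

definition uc :: "(nat \<Rightarrow> 'f::banach) \<Rightarrow> bool" where
  "uc y \<longleftrightarrow> (\<forall>r. strict_mono r \<longrightarrow> summable (\<lambda>i. y (r i)))"

definition Rosenthal_set :: "('k::real_or_complex \<Rightarrow> 'e::banach \<Rightarrow> 'e) \<Rightarrow> 'e set \<Rightarrow> bool" where
  "Rosenthal_set sE A \<longleftrightarrow>
     (\<forall>x :: nat \<Rightarrow> 'e. range x \<subseteq> A \<longrightarrow> (\<exists>r. strict_mono r \<and> weakly_Cauchy sE (x \<circ> r)))"

text \<open>The supremum is taken in \<open>ennreal\<close>, since it may be infinite.\<close>

definition Dunford_Pettis_set :: "('k::real_or_complex \<Rightarrow> 'e::banach \<Rightarrow> 'e) \<Rightarrow> 'e set \<Rightarrow> bool" where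
  "Dunford_Pettis_set sE A \<longleftrightarrow>
     (\<forall>f. weakly_null_dual sE f \<longrightarrow> (\<lambda>n. SUP x\<in>A. ennreal (norm (f n x))) \<longlonglongrightarrow> 0)"

definition rel_weakly_compact :: "('k::real_or_complex \<Rightarrow> 'f::banach \<Rightarrow> 'f) \<Rightarrow> 'f set \<Rightarrow> bool" where
  "rel_weakly_compact sF B \<longleftrightarrow> compactin (weak_topology sF) (weak_topology sF closure_of B)"

text \<open>A \<open>k\<close>-linear map takes a sequence of vectors of which only the first \<open>k\<close> entries matter.\<close>

definition multilinear ::
    "('k::real_or_complex \<Rightarrow> 'e::banach \<Rightarrow> 'e) \<Rightarrow> ('k \<Rightarrow> 'f::banach \<Rightarrow> 'f) \<Rightarrow> nat
       \<Rightarrow> ((nat \<Rightarrow> 'e) \<Rightarrow> 'f) \<Rightarrow> bool" where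
  "multilinear sE sF k A \<longleftrightarrow>
     (\<forall>v w. (\<forall>i<k. v i = w i) \<longrightarrow> A v = A w) \<and>
     (\<forall>v. \<forall>i<k. Vector_Spaces.linear sE sF (\<lambda>x. A (v(i := x))))"

definition hom_polys ::
    "('k::real_or_complex \<Rightarrow> 'e::banach \<Rightarrow> 'e) \<Rightarrow> ('k \<Rightarrow> 'f::banach \<Rightarrow> 'f) \<Rightarrow> nat
       \<Rightarrow> ('e \<Rightarrow> 'f) set" where
  "hom_polys sE sF k =
     {P. (\<exists>A. multilinear sE sF k A \<and> (\<forall>x. P x = A (\<lambda>_. x))) \<and> continuous_on UNIV P}"

definition unconditionally_converging ::
    "('k::real_or_complex \<Rightarrow> 'e::banach \<Rightarrow> 'e) \<Rightarrow> ('e \<Rightarrow> 'f::banach) \<Rightarrow> bool" where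
  "unconditionally_converging sE P \<longleftrightarrow> (\<forall>x. wuC sE x \<longrightarrow> uc (\<lambda>i. P (x i)))"

definition hom_polys_cc0 ::
    "('k::real_or_complex \<Rightarrow> 'e::banach \<Rightarrow> 'e) \<Rightarrow> ('k \<Rightarrow> 'f::banach \<Rightarrow> 'f) \<Rightarrow> nat
       \<Rightarrow> ('e \<Rightarrow> 'f) set" where
  "hom_polys_cc0 sE sF k =
     {P \<in> hom_polys sE sF k. \<forall>x. weakly_null sE x \<longrightarrow> (\<lambda>n. P (x n)) \<longlonglongrightarrow> 0}"

definition hom_polys_wd ::
    "('k::real_or_complex \<Rightarrow> 'e::banach \<Rightarrow> 'e) \<Rightarrow> ('k \<Rightarrow> 'f::banach \<Rightarrow> 'f) \<Rightarrow> nat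
       \<Rightarrow> ('e \<Rightarrow> 'f) set" where
  "hom_polys_wd sE sF k =
     {P \<in> hom_polys sE sF k. \<forall>A. Dunford_Pettis_set sE A \<longrightarrow>
        continuous_map (subtopology (weak_topology sE) A) euclidean P}"

definition hom_polys_wco ::
    "('k::real_or_complex \<Rightarrow> 'e::banach \<Rightarrow> 'e) \<Rightarrow> ('k \<Rightarrow> 'f::banach \<Rightarrow> 'f) \<Rightarrow> nat
       \<Rightarrow> ('e \<Rightarrow> 'f) set" where
  "hom_polys_wco sE sF k =
     {P \<in> hom_polys sE sF k. \<forall>B. bounded B \<longrightarrow> rel_weakly_compact sF (P ` B)}"

end

theory Submission
  imports Defs
begin

text \<open>All four cases rest on one reduction: if \<open>P\<close> is not unconditionally converging, then there are a
  w.u.C. series \<open>\<Sum> y n\<close> and \<open>e > 0\<close> with \<open>e \<le> norm (P (y n))\<close> for all \<open>n\<close>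
  (\<open>wuC_with_large_values\<close>). Divergence of a subseries of \<open>\<Sum> P (x i)\<close> gives disjoint blocks whose sums
  \<open>\<Sum> P (x i)\<close> stay away from \<open>0\<close>. Polarizing \<open>P\<close> and averaging over signs writes such a sum as a multiple
  of a mean of signed values of \<open>P\<close> at combinations of the \<open>x i\<close> with coefficients at most \<open>k\<close>, so one
  of these combinations is a suitable \<open>y n\<close> (\<open>sum_diagonal_differences_le\<close>). Everything about
  polynomials is expressed by forward differences, which behave well under restriction, translation and
  composition with functionals.

  The second tool is that \<open>g (P (w + y n))\<close> tends to \<open>g (P w)\<close> for every functional \<open>g\<close> and every w.u.C.
  series \<open>\<Sum> y n\<close> (\<open>scalar_polynomial_tendsto\<close>): by induction on the degree, values \<open>q (y n)\<close> that do
  not tend to \<open>q 0\<close> would add up along a sparse partial sum, while all such sums are bounded.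

  Given \<open>y\<close> as above, case (a) is immediate, because \<open>y\<close> is weakly null. In case (b) the range of \<open>y\<close>
  is a Rosenthal set; a cluster point of \<open>P (y n)\<close> is nonzero, yet all functionals vanish there by the
  second tool. In case (c) the range of \<open>y\<close> together with \<open>0\<close> is a Dunford--Pettis set, by the sliding hump
  argument that proves the Schur property of the space of absolutely summable sequences. In case (d), take
  functionals \<open>g n\<close> norming \<open>P (y n)\<close> and a weak* cluster point \<open>h\<close> of them. A gliding hump produces
  bounded partial sums \<open>W j\<close>, built from a subsequence of \<open>y\<close> with coefficients in \<open>{0..k}\<close>, such that the
  \<open>j\<close>-th functional sees a jump between \<open>P (W j)\<close> and \<open>P (W (j + 1))\<close> and only negligible changes
  later on, whereas on each \<open>P (W i)\<close> the functionals approach \<open>h\<close>. A weak cluster point \<open>z\<close>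
  of the \<open>P (W j)\<close> inherits the gap between \<open>g n z\<close> and \<open>h z\<close>; but \<open>z\<close> lies in the closed span of the
  \<open>P (W j)\<close>, where the gap closes. The double limit replaces the weakly convergent sums that
  Krein's theorem would provide.

  The functional analysis is derived for real functionals on the underlying real Banach space and transferred
  to the scalar field by \<open>real_functional_factors_through_dual\<close>.\<close>

section \<open>Forward differences and degree\<close>

definition fwd_diff :: "'a::ab_group_add \<Rightarrow> ('a \<Rightarrow> 'b::ab_group_add) \<Rightarrow> 'a \<Rightarrow> 'b" where
  "fwd_diff h f w = f (w + h) - f w"

text \<open>Frechet's definition of a polynomial map of degree at most \<open>k\<close>. Passing to \<open>fwd_diff h f\<close> lowers
  the bound by one, which is what the inductions on the degree below use.\<close>

primrec degree_le :: "nat \<Rightarrow> ('a::ab_group_add \<Rightarrow> 'b::ab_group_add) \<Rightarrow> bool" where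
  "degree_le 0 f \<longleftrightarrow> (\<forall>h w. fwd_diff h f w = 0)"
| "degree_le (Suc k) f \<longleftrightarrow> (\<forall>h. degree_le k (fwd_diff h f))"

lemma fwd_diff_sum: "fwd_diff h (\<lambda>w. \<Sum>i\<in>I. f i w) = (\<lambda>w. \<Sum>i\<in>I. fwd_diff h (f i) w)"
  by (simp add: fwd_diff_def fun_eq_iff sum_subtractf)

lemma degree_le_sum: "(\<And>i. i \<in> I \<Longrightarrow> degree_le k (f i)) \<Longrightarrow> degree_le k (\<lambda>w. \<Sum>i\<in>I. f i w)"
  by (induction k arbitrary: f) (simp_all add: fwd_diff_sum)

lemma fwd_diff_funpow_sum:
  "(fwd_diff h ^^ k) (\<lambda>w. \<Sum>i\<in>I. f i w) = (\<lambda>w. \<Sum>i\<in>I. (fwd_diff h ^^ k) (f i) w)"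
  by (induction k) (simp_all add: fwd_diff_sum)

lemma fwd_diff_funpow_add:
  "(fwd_diff h ^^ k) (\<lambda>w. f w + g w) = (\<lambda>w. (fwd_diff h ^^ k) f w + (fwd_diff h ^^ k) g w)"
  by (induction k) (simp_all add: fwd_diff_def fun_eq_iff)

lemma fwd_diff_funpow_translate:
  "(fwd_diff h ^^ k) (\<lambda>w. f (w + v)) = (\<lambda>w. (fwd_diff h ^^ k) f (w + v))"
  by (induction k) (simp_all add: fwd_diff_def fun_eq_iff ac_simps)

lemma fwd_diff_funpow_compose_additive:
  assumes "\<And>x y. g (x - y) = g x - g y"
  shows "(fwd_diff h ^^ k) (\<lambda>w. g (f w)) = (\<lambda>w. g ((fwd_diff h ^^ k) f w))"
  by (induction k) (simp_all add: fwd_diff_def fun_eq_iff assms)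

lemma fwd_diff_funpow_const: "(fwd_diff h ^^ Suc k) (\<lambda>_. c) = (\<lambda>_. 0)"
  by (induction k) (simp_all add: fwd_diff_def fun_eq_iff)

text \<open>The \<open>k\<close>-th difference is a signed sum, with \<open>2 ^ k\<close> terms counted with multiplicity, of values at
  the points \<open>w + t y\<close>.\<close>

lemma fwd_diff_funpow_le:
  fixes f :: "'e::real_vector \<Rightarrow> 'f::real_normed_vector"
  assumes "\<And>t. t \<le> k \<Longrightarrow> norm (f (w + real t *\<^sub>R y)) \<le> M"
  shows "norm ((fwd_diff y ^^ k) f w) \<le> 2 ^ k * M"
  using assms
proof (induction k arbitrary: w)
  case 0
  from 0[of 0] show ?case by simp
next
  case (Suc k)
  have "norm ((fwd_diff y ^^ k) f w) \<le> 2 ^ k * M" by (rule Suc.IH) (rule Suc.prems, simp)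
  moreover have "norm ((fwd_diff y ^^ k) f (w + y)) \<le> 2 ^ k * M"
  proof (rule Suc.IH)
    fix t assume "t \<le> k"
    then show "norm (f (w + y + real t *\<^sub>R y)) \<le> M"
      using Suc.prems[of "Suc t"] by (simp add: scaleR_add_left algebra_simps)
  qed
  ultimately have "norm ((fwd_diff y ^^ k) f (w + y) - (fwd_diff y ^^ k) f w) \<le> 2 * (2 ^ k * M)"
    using norm_triangle_ineq4[of "(fwd_diff y ^^ k) f (w + y)" "(fwd_diff y ^^ k) f w"] by linarith
  then show ?case by (simp add: fwd_diff_def[of y "(fwd_diff y ^^ k) f"])
qed

lemma degree_le_const: "degree_le 0 f \<Longrightarrow> f w = f w'"
  by (simp add: fwd_diff_def) (metis add.commute diff_add_cancel)

lemma degree_le_funpow_const: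
  assumes "degree_le k f"
  shows "(fwd_diff h ^^ k) f w = (fwd_diff h ^^ k) f w'"
  using assms
proof (induction k arbitrary: f)
  case 0
  then show ?case by (simp add: degree_le_const del: degree_le.simps)
next
  case (Suc k)
  then have "(fwd_diff h ^^ k) (fwd_diff h f) w = (fwd_diff h ^^ k) (fwd_diff h f) w'" by simp
  then show ?case by (simp add: funpow_swap1)
qed

lemma fwd_diff_plus:
  "fwd_diff (u + v) f = (\<lambda>w. fwd_diff u f (w + v) + fwd_diff v f w)"
  by (simp add: fwd_diff_def fun_eq_iff ac_simps)

text \<open>The top differences of a function of degree \<open>k + 1\<close> form a multiadditive map, as polarization asks;
  this is additivity in one slot.\<close>

lemma fwd_diff_additive_direction:
  assumes "degree_le (Suc k) f"
  shows "(fwd_diff h ^^ k) (fwd_diff (u + v) f) w =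
         (fwd_diff h ^^ k) (fwd_diff u f) w + (fwd_diff h ^^ k) (fwd_diff v f) w"
proof -
  have "(fwd_diff h ^^ k) (fwd_diff u f) (w + v) = (fwd_diff h ^^ k) (fwd_diff u f) w"
    using assms by (intro degree_le_funpow_const) simp
  then show ?thesis
    by (simp add: fwd_diff_plus fwd_diff_funpow_add fwd_diff_funpow_translate)
qed

lemma degree_le_compose_additive:
  assumes "\<And>x y. g (x - y) = g x - g y" and "degree_le k f"
  shows "degree_le k (\<lambda>w. g (f w))"
  using assms(2)
proof (induction k arbitrary: f)
  case 0
  have "g 0 = 0" using assms(1)[of 0 0] by simp
  with 0 show ?case by (simp add: fwd_diff_def flip: assms(1))
next
  case (Suc k)
  have "fwd_diff h (\<lambda>w. g (f w)) = (\<lambda>w. g (fwd_diff h f w))" for h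
    by (simp add: fwd_diff_def fun_eq_iff assms(1))
  with Suc show ?case by simp
qed

section \<open>Recovering a diagonal sum from one value\<close>

text \<open>Averaged over independent signs, the full double sum of \<open>\<sigma> i \<sigma> l (b i (x l))\<close> equals its
  diagonal, so some choice of signs does at least as well as the diagonal. The constant \<open>c\<close> makes
  the induction on \<open>B\<close> work: it takes up the diagonal terms that are already split off.\<close>

lemma signs_diagonal_le:
  fixes x :: "'i \<Rightarrow> 'e::real_vector" and b :: "'i \<Rightarrow> 'e \<Rightarrow> 'f::real_normed_vector"
  assumes "finite B" and add: "\<And>i u v. b i (u + v) = b i u + b i v"
  shows "\<exists>\<sigma>. (\<forall>i. \<sigma> i \<in> {-1, 1::real}) \<and>
    norm (c + (\<Sum>i\<in>B. b i (x i)))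
      \<le> norm (c + (\<Sum>i\<in>B. \<sigma> i *\<^sub>R b i (\<Sum>l\<in>B. \<sigma> l *\<^sub>R x l)))"
  using assms(1)
proof (induction B arbitrary: c rule: finite_induct)
  case empty
  show ?case by (intro exI[of _ "\<lambda>_. 1"]) simp
next
  case (insert j B)
  have b0: "b i 0 = 0" for i using add[of i 0 0] by simp
  have bm: "b i (- u) = - b i u" for i u
    using add[of i u "- u"] b0[of i] by (simp add: eq_neg_iff_add_eq_0 add.commute)
  from insert.IH[of "c + b j (x j)"] obtain \<sigma> where \<sigma>: "\<And>i. \<sigma> i \<in> {-1, 1::real}"
    and le: "norm (c + b j (x j) + (\<Sum>i\<in>B. b i (x i)))
      \<le> norm (c + b j (x j) + (\<Sum>i\<in>B. \<sigma> i *\<^sub>R b i (\<Sum>l\<in>B. \<sigma> l *\<^sub>R x l)))"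
    by blast
  define U where "U = (\<Sum>l\<in>B. \<sigma> l *\<^sub>R x l)"
  define V where "V u = (\<Sum>i\<in>B. \<sigma> i *\<^sub>R b i u)" for u
  have V: "V (u + v) = V u + V v" "V (- v) = - V v" for u v
    by (simp_all add: V_def add bm scaleR_add_right sum.distrib sum_negf)
  have minus: "V (u - v) = V u - V v" "b i (u - v) = b i u - b i v" for u v i
    using V(1)[of u "- v"] add[of i u "- v"] by (simp_all add: V(2) bm)
  define X where "X s = c + s *\<^sub>R b j (s *\<^sub>R x j + U) + V (s *\<^sub>R x j + U)" for s :: real
  have upd: "c + (\<Sum>i\<in>insert j B. (\<sigma>(j := s)) i *\<^sub>R
      b i (\<Sum>l\<in>insert j B. (\<sigma>(j := s)) l *\<^sub>R x l)) = X s" for s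
  proof -
    have "(\<Sum>l\<in>insert j B. (\<sigma>(j := s)) l *\<^sub>R x l) = s *\<^sub>R x j + U"
      using insert.hyps by (auto simp: U_def intro!: sum.cong)
    moreover have "(\<Sum>i\<in>insert j B. (\<sigma>(j := s)) i *\<^sub>R b i u) = s *\<^sub>R b j u + V u" for u
      using insert.hyps by (auto simp: V_def intro!: sum.cong)
    ultimately show ?thesis by (simp add: X_def)
  qed
  \<comment> \<open>The mixed terms carry the new sign once, so they cancel in the mean of the two choices.\<close>
  have "X 1 + X (-1) = 2 *\<^sub>R (c + b j (x j) + V U)"
    by (simp add: X_def add V bm minus scaleR_2 algebra_simps)
  then have "norm (2 *\<^sub>R (c + b j (x j) + V U)) \<le> norm (X 1) + norm (X (-1))"
    using norm_triangle_ineq[of "X 1" "X (-1)"] by (simp only:)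
  then have "2 * norm (c + b j (x j) + V U) \<le> norm (X 1) + norm (X (-1))"
    by simp
  then have "norm (c + b j (x j) + V U) \<le> norm (X 1) \<or> norm (c + b j (x j) + V U) \<le> norm (X (-1))"
    by linarith
  then obtain s where s: "s \<in> {-1, 1}" "norm (c + b j (x j) + V U) \<le> norm (X s)" by blast
  have "norm (c + (\<Sum>i\<in>insert j B. b i (x i))) \<le> norm (c + b j (x j) + V U)"
    using le insert.hyps by (simp add: U_def V_def add.assoc)
  with s(2) have "norm (c + (\<Sum>i\<in>insert j B. b i (x i))) \<le> norm (X s)" by linarith
  with s(1) \<sigma> show ?case
    by (intro exI[of _ "\<sigma>(j := s)"] conjI) (simp_all only: upd, simp)
qed

text \<open>Each step trades one of the \<open>k + 1\<close> equal directions \<open>x i\<close> for a common direction \<open>U\<close>, a signed sum of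
  all the \<open>x i\<close>, and continues with \<open>fwd_diff U f\<close>. The coefficients \<open>\<rho>\<close> collect the signs met so
  far. The difference in direction \<open>U\<close> is undone at the price of a factor \<open>2\<close> and of coefficients
  larger by \<open>1\<close>.\<close>

lemma sum_diagonal_differences_le:
  fixes x :: "'i \<Rightarrow> 'e::real_vector" and f :: "'e \<Rightarrow> 'f::real_normed_vector"
  assumes "finite B" and "degree_le (Suc k) f" and "\<And>i. \<rho> i \<in> {-1, 1::real}"
  shows "\<exists>a. (\<forall>i. \<bar>a i\<bar> \<le> real (Suc k)) \<and>
    norm (\<Sum>i\<in>B. \<rho> i *\<^sub>R (fwd_diff (x i) ^^ Suc k) f 0)
      \<le> 2 ^ Suc k * norm (f (\<Sum>i\<in>B. a i *\<^sub>R x i))"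
  using assms(2,3)
proof (induction k arbitrary: f \<rho>)
  case 0
  have add: "fwd_diff (u + v) f 0 = fwd_diff u f 0 + fwd_diff v f 0" for u v
    using fwd_diff_additive_direction[of 0 f _ u v 0] 0(1) by simp
  have zero: "fwd_diff 0 f 0 = 0" by (simp add: fwd_diff_def)
  have neg: "fwd_diff (- u) f 0 = - fwd_diff u f 0" for u
    using add[of u "- u"] zero by (simp add: eq_neg_iff_add_eq_0 add.commute)
  have sgn: "\<rho> i *\<^sub>R fwd_diff u f 0 = fwd_diff (\<rho> i *\<^sub>R u) f 0" for i u
    using 0(2)[of i] by (auto simp: neg)
  have "(\<Sum>i\<in>B. \<rho> i *\<^sub>R fwd_diff (x i) f 0) = fwd_diff (\<Sum>i\<in>B. \<rho> i *\<^sub>R x i) f 0"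
    unfolding sgn by (induction B rule: infinite_finite_induct) (simp_all add: zero add)
  also have "\<dots> = f (\<Sum>i\<in>B. \<rho> i *\<^sub>R x i) - f (\<Sum>i\<in>B. 0 *\<^sub>R x i)"
    by (simp add: fwd_diff_def)
  finally have "norm (\<Sum>i\<in>B. \<rho> i *\<^sub>R fwd_diff (x i) f 0)
      \<le> norm (f (\<Sum>i\<in>B. \<rho> i *\<^sub>R x i)) + norm (f (\<Sum>i\<in>B. 0 *\<^sub>R x i))"
    by (metis norm_triangle_ineq4)
  then have "norm (\<Sum>i\<in>B. \<rho> i *\<^sub>R fwd_diff (x i) f 0) \<le> 2 * norm (f (\<Sum>i\<in>B. \<rho> i *\<^sub>R x i)) \<or>
      norm (\<Sum>i\<in>B. \<rho> i *\<^sub>R fwd_diff (x i) f 0) \<le> 2 * norm (f (\<Sum>i\<in>B. 0 *\<^sub>R x i))"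
    by linarith
  moreover have "\<bar>\<rho> i\<bar> \<le> 1" for i using 0(2)[of i] by auto
  ultimately show ?case
    by (elim disjE; intro exI[of _ \<rho>] exI[of _ "\<lambda>_. 0"]) auto
next
  case (Suc k)
  define b where "b i u = \<rho> i *\<^sub>R (fwd_diff (x i) ^^ Suc k) (fwd_diff u f) 0" for i u
  have "b i (u + v) = b i u + b i v" for i u v
    using fwd_diff_additive_direction[OF Suc.prems(1), of "x i" u v 0]
    by (simp only: b_def scaleR_add_right)
  from signs_diagonal_le[of B b 0 x, OF assms(1) this] obtain \<sigma>
    where \<sigma>: "\<And>i. \<sigma> i \<in> {-1, 1::real}"
      and le: "norm (\<Sum>i\<in>B. b i (x i)) \<le> norm (\<Sum>i\<in>B. \<sigma> i *\<^sub>R b i (\<Sum>l\<in>B. \<sigma> l *\<^sub>R x l))"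
    by auto
  define U where "U = (\<Sum>l\<in>B. \<sigma> l *\<^sub>R x l)"
  have "degree_le (Suc k) (fwd_diff U f)" using Suc.prems(1) by simp
  moreover have "\<sigma> i * \<rho> i \<in> {-1, 1}" for i using \<sigma>[of i] Suc.prems(2)[of i] by auto
  ultimately obtain a where a: "\<And>i. \<bar>a i\<bar> \<le> real (Suc k)"
    and le2: "norm (\<Sum>i\<in>B. (\<sigma> i * \<rho> i) *\<^sub>R (fwd_diff (x i) ^^ Suc k) (fwd_diff U f) 0)
      \<le> 2 ^ Suc k * norm (fwd_diff U f (\<Sum>i\<in>B. a i *\<^sub>R x i))"
    using Suc.IH[of "fwd_diff U f" "\<lambda>i. \<sigma> i * \<rho> i"] by blast
  let ?L = "norm (\<Sum>i\<in>B. \<rho> i *\<^sub>R (fwd_diff (x i) ^^ Suc (Suc k)) f 0)"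
  have "?L = norm (\<Sum>i\<in>B. b i (x i))"
    by (simp add: b_def funpow_swap1)
  also have "\<dots> \<le> 2 ^ Suc k * norm (fwd_diff U f (\<Sum>i\<in>B. a i *\<^sub>R x i))"
    using le le2 by (simp add: b_def U_def)
  also have "\<dots> \<le> 2 ^ Suc k * (norm (f (\<Sum>i\<in>B. (a i + \<sigma> i) *\<^sub>R x i)) + norm (f (\<Sum>i\<in>B. a i *\<^sub>R x i)))"
    by (intro mult_left_mono) (simp_all add: fwd_diff_def U_def scaleR_add_left sum.distrib norm_triangle_ineq4)
  finally have "?L \<le> 2 ^ Suc k * norm (f (\<Sum>i\<in>B. (a i + \<sigma> i) *\<^sub>R x i)) +
    2 ^ Suc k * norm (f (\<Sum>i\<in>B. a i *\<^sub>R x i))" by (simp add: algebra_simps)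
  then have "?L \<le> 2 ^ Suc (Suc k) * norm (f (\<Sum>i\<in>B. (a i + \<sigma> i) *\<^sub>R x i)) \<or>
      ?L \<le> 2 ^ Suc (Suc k) * norm (f (\<Sum>i\<in>B. a i *\<^sub>R x i))"
    by (simp only: power_Suc[of 2 "Suc k"]) linarith
  moreover have "\<bar>a i + \<sigma> i\<bar> \<le> real (Suc (Suc k))" "\<bar>a i\<bar> \<le> real (Suc (Suc k))" for i
    using a[of i] \<sigma>[of i] by auto
  ultimately show ?case
    by (elim disjE; intro exI[of _ "\<lambda>i. a i + \<sigma> i"] exI[of _ a]) simp_all
qed

section \<open>Homogeneous polynomials as functions of bounded degree\<close>

text \<open>The increment is telescoped slot by slot, in increasing order of the slots.\<close>

lemma multiadditive_increment:
  fixes A :: "(nat \<Rightarrow> 'e::ab_group_add) \<Rightarrow> 'f::ab_group_add"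
  assumes add: "\<And>v i x y. i < k \<Longrightarrow> A (v(i := x + y)) = A (v(i := x)) + A (v(i := y))"
    and "finite S" "S \<subseteq> {..<k}"
  shows "A (\<lambda>j. if j \<in> S then u j + h else u j) - A u =
    (\<Sum>i\<in>S. A (\<lambda>j. if j = i then h else if j \<in> S \<and> j < i then u j + h else u j))"
  using assms(2,3)
proof (induction S rule: finite_linorder_max_induct)
  case empty
  then show ?case by simp
next
  case (insert b S)
  define v where "v = (\<lambda>j. if j \<in> S then u j + h else u j)"
  have bS: "b \<notin> S" using insert.hyps by auto
  have v1: "(\<lambda>j. if j \<in> insert b S then u j + h else u j) = v(b := u b + h)"
    and v2: "v = v(b := u b)"
    using bS by (auto simp: v_def fun_eq_iff)
  have "A (\<lambda>j. if j \<in> insert b S then u j + h else u j) - A u =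
      A (v(b := u b + h)) - A (v(b := u b)) + (A v - A u)"
    unfolding v1 using v2 by simp
  also have "\<dots> = A (v(b := h)) + (\<Sum>i\<in>S. A (\<lambda>j. if j = i then h else if j \<in> S \<and> j < i then u j + h else u j))"
    using insert.IH insert.prems add[of b v "u b" h] by (simp add: v_def)
  also have "(\<Sum>i\<in>S. A (\<lambda>j. if j = i then h else if j \<in> S \<and> j < i then u j + h else u j)) =
     (\<Sum>i\<in>S. A (\<lambda>j. if j = i then h else if j \<in> insert b S \<and> j < i then u j + h else u j))"
    using insert.hyps by (intro sum.cong refl arg_cong[of _ _ A]) (auto simp: fun_eq_iff)
  also have "v(b := h) = (\<lambda>j. if j = b then h else if j \<in> insert b S \<and> j < b then u j + h else u j)"
    using insert.hyps by (auto simp: v_def fun_eq_iff)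
  finally show ?case using bS insert.hyps by simp
qed

text \<open>Freezing some slots and allowing offsets \<open>c\<close> in the others gives a family of functions closed under
  differences: by \<open>multiadditive_increment\<close> a difference is a sum of members with one free slot fewer.
  Each of the \<open>m\<close> free slots may be the one that is frozen, whence the factorial.\<close>

lemma multiadditive_degree_le:
  fixes A :: "(nat \<Rightarrow> 'e::ab_group_add) \<Rightarrow> 'f::real_vector"
  assumes add: "\<And>v i x y. i < k \<Longrightarrow> A (v(i := x + y)) = A (v(i := x)) + A (v(i := y))"
    and "S \<subseteq> {..<k}" "card S = m"
  shows "degree_le m (\<lambda>w. A (\<lambda>i. if i \<in> S then w + c i else c i)) \<and>
    (\<forall>h w. (fwd_diff h ^^ m) (\<lambda>w. A (\<lambda>i. if i \<in> S then w + c i else c i)) w =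
       fact m *\<^sub>R A (\<lambda>i. if i \<in> S then h else c i))"
  using assms(2,3)
proof (induction m arbitrary: S c)
  case 0
  then have "S = {}" using finite_subset by fastforce
  then show ?case by (simp add: fwd_diff_def)
next
  case (Suc m)
  have fin: "finite S" using Suc.prems finite_subset by blast
  define F where "F S c w = A (\<lambda>i. if i \<in> S then w + c i else c i)" for S c and w :: 'e
  define c' where "c' h i j = (if j = i then h else if j \<in> S \<and> j < i then c j + h else c j)" for h i j
  have diff: "fwd_diff h (F S c) = (\<lambda>w. \<Sum>i\<in>S. F (S - {i}) (c' h i) w)" for h
  proof
    fix w
    define u where "u j = (if j \<in> S then w + c j else c j)" for j
    have "fwd_diff h (F S c) w = A (\<lambda>j. if j \<in> S then u j + h else u j) - A u"
      by (auto simp: fwd_diff_def F_def u_def intro!: arg_cong2[of _ _ _ _ minus] arg_cong[of _ _ A])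
    also have "\<dots> = (\<Sum>i\<in>S. A (\<lambda>j. if j = i then h else if j \<in> S \<and> j < i then u j + h else u j))"
      by (rule multiadditive_increment[OF add fin Suc.prems(1)])
    also have "\<dots> = (\<Sum>i\<in>S. F (S - {i}) (c' h i) w)"
      by (auto simp: F_def u_def c'_def fun_eq_iff intro!: sum.cong arg_cong[of _ _ A])
    finally show "fwd_diff h (F S c) w = (\<Sum>i\<in>S. F (S - {i}) (c' h i) w)" .
  qed
  have IH: "degree_le m (F (S - {i}) d) \<and> (\<forall>h w. (fwd_diff h ^^ m) (F (S - {i}) d) w =
       fact m *\<^sub>R A (\<lambda>j. if j \<in> S - {i} then h else d j))" if "i \<in> S" for i d
    unfolding F_def by (rule Suc.IH) (use that fin Suc.prems in auto)
  have "degree_le (Suc m) (F S c)"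
    using IH by (simp add: diff degree_le_sum)
  moreover have "(fwd_diff h ^^ Suc m) (F S c) w = fact (Suc m) *\<^sub>R A (\<lambda>i. if i \<in> S then h else c i)" for h w
  proof -
    have "(fwd_diff h ^^ Suc m) (F S c) w = (\<Sum>i\<in>S. (fwd_diff h ^^ m) (F (S - {i}) (c' h i)) w)"
      by (simp add: funpow_swap1 diff fwd_diff_funpow_sum)
    also have "\<dots> = (\<Sum>i\<in>S. fact m *\<^sub>R A (\<lambda>j. if j \<in> S then h else c j))"
    proof (intro sum.cong refl)
      fix i assume "i \<in> S"
      then have "(\<lambda>j. if j \<in> S - {i} then h else c' h i j) = (\<lambda>j. if j \<in> S then h else c j)"
        by (auto simp: c'_def fun_eq_iff)
      then show "(fwd_diff h ^^ m) (F (S - {i}) (c' h i)) w = fact m *\<^sub>R A (\<lambda>j. if j \<in> S then h else c j)"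
        using IH[OF \<open>i \<in> S\<close>, of "c' h i"] by simp
    qed
    also have "\<dots> = fact (Suc m) *\<^sub>R A (\<lambda>j. if j \<in> S then h else c j)"
      using Suc.prems by (simp add: sum_constant_scaleR)
    finally show ?thesis .
  qed
  ultimately show ?case by (simp add: F_def[abs_def])
qed

lemma hom_polys_differences:
  fixes sE :: "'k::real_or_complex \<Rightarrow> 'e::banach \<Rightarrow> 'e" and sF :: "'k \<Rightarrow> 'f::banach \<Rightarrow> 'f"
  assumes E: "banach_space_over sE" and F: "banach_space_over sF" and P: "P \<in> hom_polys sE sF k"
  shows hom_polys_degree_le: "degree_le k P"
    and hom_polys_funpow_fwd_diff: "(fwd_diff h ^^ k) P w = fact k *\<^sub>R P h"
    and hom_polys_scaleR: "P (r *\<^sub>R x) = r ^ k *\<^sub>R P x"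
proof -
  obtain A where dep: "\<And>v w. (\<forall>i<k. v i = w i) \<Longrightarrow> A v = A w"
    and lin: "\<And>v i. i < k \<Longrightarrow> Vector_Spaces.linear sE sF (\<lambda>x. A (v(i := x)))"
    and PA: "\<And>x. P x = A (\<lambda>_. x)"
    using P unfolding hom_polys_def multilinear_def by blast
  have add: "A (v(i := x + y)) = A (v(i := x)) + A (v(i := y))" if "i < k" for v i x y
    using lin[OF that, of v] by (simp add: Vector_Spaces.linear_iff)
  have P_eq: "P = (\<lambda>w. A (\<lambda>i. if i < k then w + 0 else 0))"
    unfolding PA by (intro ext dep) simp
  have diag: "A (\<lambda>i. if i < k then h else 0) = P h" for h
    unfolding PA by (intro dep) simp
  show "degree_le k P" "(fwd_diff h ^^ k) P w = fact k *\<^sub>R P h"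
    using multiadditive_degree_le[where A = A and S = "{..<k}" and c = "\<lambda>_. 0", OF add, of k]
    by (simp_all add: diag flip: P_eq)
  have "A (\<lambda>i. if i < m then r *\<^sub>R x else x) = r ^ m *\<^sub>R P x" if "m \<le> k" for m
    using that
  proof (induction m)
    case 0
    then show ?case by (simp add: PA)
  next
    case (Suc m)
    define v where "v = (\<lambda>i. if i < m then r *\<^sub>R x else x)"
    have "A (v(m := sE (of_real r) x)) = sF (of_real r) (A (v(m := x)))"
      using lin[of m v] Suc.prems by (simp add: Vector_Spaces.linear_iff)
    moreover have "v(m := x) = v" by (auto simp: v_def)
    moreover have "(\<lambda>i. if i < Suc m then r *\<^sub>R x else x) = v(m := r *\<^sub>R x)"
      by (auto simp: v_def fun_eq_iff)
    ultimately show ?case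
      using Suc by (simp add: v_def banach_space_over.scale_of_real[OF E] banach_space_over.scale_of_real[OF F])
  qed
  from this[of k] show "P (r *\<^sub>R x) = r ^ k *\<^sub>R P x"
    unfolding PA using dep[of "\<lambda>i. if i < k then r *\<^sub>R x else x" "\<lambda>_. r *\<^sub>R x"] by simp
qed

lemma hom_polys_zero:
  assumes "banach_space_over sE" "banach_space_over sF" "k \<ge> 1" "P \<in> hom_polys sE sF k"
  shows "P 0 = 0"
  using hom_polys_scaleR[OF assms(1,2,4), of 0 0] assms(3) by (simp add: power_0_left)

text \<open>Serves both for polynomials and, with \<open>k = 1\<close>, for the continuous linear forms that make up the
  dual.\<close>

lemma homogeneous_norm_bound:
  fixes f :: "'a::real_normed_vector \<Rightarrow> 'b::real_normed_vector"
  assumes hom: "\<And>r x. f (r *\<^sub>R x) = r ^ k *\<^sub>R f x" and cont: "continuous_on UNIV f" and k: "k \<ge> 1"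
  shows "\<exists>C\<ge>0. \<forall>x. norm (f x) \<le> C * norm x ^ k"
proof -
  have f0: "f 0 = 0" using hom[of 0 0] k by (cases k) auto
  have "isCont f 0" using cont by (simp add: continuous_on_eq_continuous_at)
  then obtain d where d: "d > 0" "\<And>x. norm x < d \<Longrightarrow> norm (f x) < 1"
    unfolding continuous_at_eps_delta using f0 by (metis dist_norm diff_zero zero_less_one)
  have "norm (f x) \<le> (2 / d) ^ k * norm x ^ k" for x
  proof (cases "x = 0")
    case True
    then show ?thesis using f0 d by simp
  next
    case False
    define t where "t = (2 / d) * norm x"
    have t: "t > 0" using False d by (simp add: t_def)
    have "norm (inverse t *\<^sub>R x) < d" using False d by (simp add: t_def field_simps)
    then have "norm (f (inverse t *\<^sub>R x)) < 1" by (rule d)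
    moreover have "f x = t ^ k *\<^sub>R f (inverse t *\<^sub>R x)" using hom[of t "inverse t *\<^sub>R x"] t by simp
    ultimately have "norm (f x) \<le> t ^ k" using t by (simp add: mult_left_le)
    then show ?thesis by (simp only: t_def power_mult_distrib)
  qed
  then show ?thesis using d by (intro exI[of _ "(2 / d) ^ k"]) simp
qed

section \<open>The Hahn--Banach theorem and uniform boundedness\<close>

text \<open>The inequality for \<open>t\<close> and the one for its inverse together give positive homogeneity; in this form
  sublinearity of an infimum is easier to check.\<close>

definition sublinear :: "('a::real_vector \<Rightarrow> real) \<Rightarrow> bool" where
  "sublinear p \<longleftrightarrow> (\<forall>x y. p (x + y) \<le> p x + p y) \<and> (\<forall>t x. 0 < t \<longrightarrow> p (t *\<^sub>R x) \<le> t * p x)"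

lemma sublinear_add: "sublinear p \<Longrightarrow> p (x + y) \<le> p x + p y"
  by (simp add: sublinear_def)

lemma sublinear_zero: "sublinear p \<Longrightarrow> p 0 = 0"
proof -
  assume "sublinear p"
  then have "p (2 *\<^sub>R 0) \<le> 2 * p 0" "p ((1/2) *\<^sub>R 0) \<le> (1/2) * p 0"
    unfolding sublinear_def by (metis zero_less_numeral, metis half_gt_zero_iff zero_less_one)
  then show "p 0 = 0" by simp
qed

lemma sublinear_scale:
  assumes "sublinear p" "0 \<le> t"
  shows "p (t *\<^sub>R x) = t * p x"
proof (cases "t = 0")
  case True
  then show ?thesis using assms sublinear_zero by simp
next
  case False
  with assms(2) have t: "0 < t" by simp
  have *: "p (s *\<^sub>R y) \<le> s * p y" if "0 < s" for s y
    using assms(1) that by (simp add: sublinear_def)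
  have "p x \<le> inverse t * p (t *\<^sub>R x)"
    using *[of "inverse t" "t *\<^sub>R x"] t by simp
  then show ?thesis using *[OF t, of x] t by (simp add: field_simps)
qed

lemma sublinear_lower: "sublinear p \<Longrightarrow> - p (- x) \<le> p x"
  using sublinear_add[of p x "- x"] sublinear_zero[of p] by simp

text \<open>The witness is the largest sublinear function below \<open>p\<close> that is at most \<open>- p x0\<close> at \<open>- x0\<close>, namely the infimum
  over \<open>t \<ge> 0\<close> of \<open>p (x + t x0) - t p x0\<close>.\<close>

lemma sublinear_descend:
  assumes "sublinear p"
  shows "\<exists>q. sublinear q \<and> q \<le> p \<and> (\<forall>x. q x \<le> p (x + x0) - p x0)"
proof -
  define g where "g x t = p (x + t *\<^sub>R x0) - t * p x0" for x t
  define q where "q x = (INF t\<in>{0..}. g x t)" for x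
  have "- p (- x) \<le> g x t" if "t \<ge> 0" for x t
    using sublinear_add[OF assms, of "x + t *\<^sub>R x0" "- x"] sublinear_scale[OF assms that, of x0]
    by (simp add: g_def)
  then have "bdd_below (g x ` {0..})" for x
    by (auto simp: bdd_below_def)
  then have lower: "q x \<le> g x t" if "t \<ge> 0" for x t
    unfolding q_def using that by (intro cINF_lower) auto
  have greatest: "m \<le> q x" if "\<And>t. t \<ge> 0 \<Longrightarrow> m \<le> g x t" for m x
    unfolding q_def using that by (intro cINF_greatest) auto
  have "q (x + y) \<le> q x + q y" for x y
  proof -
    have "q (x + y) \<le> g x s + g y t" if "s \<ge> 0" "t \<ge> 0" for s t
    proof -
      have "q (x + y) \<le> g (x + y) (s + t)" using that by (intro lower) simp
      also have "\<dots> \<le> g x s + g y t"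
        using sublinear_add[OF assms, of "x + s *\<^sub>R x0" "y + t *\<^sub>R x0"] by (simp add: g_def algebra_simps)
      finally show ?thesis .
    qed
    then have "q (x + y) - g x s \<le> q y" if "s \<ge> 0" for s
      using that by (intro greatest) (simp add: diff_le_eq add.commute)
    then have "q (x + y) - q y \<le> q x"
      by (intro greatest) (simp add: algebra_simps)
    then show ?thesis by simp
  qed
  moreover have "q (c *\<^sub>R x) \<le> c * q x" if "0 < c" for c x
  proof -
    have "q (c *\<^sub>R x) / c \<le> q x"
    proof (rule greatest)
      fix t :: real assume "t \<ge> 0"
      have "q (c *\<^sub>R x) \<le> g (c *\<^sub>R x) (c * t)" using that \<open>t \<ge> 0\<close> by (intro lower) simp
      also have "\<dots> = c * g x t"
        using sublinear_scale[OF assms, of c "x + t *\<^sub>R x0"] that by (simp add: g_def algebra_simps)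
      finally show "q (c *\<^sub>R x) / c \<le> g x t" using that by (simp add: field_simps)
    qed
    then show ?thesis using that by (simp add: field_simps)
  qed
  moreover have "q \<le> p" using lower[of 0] by (simp add: le_fun_def g_def)
  moreover have "q x \<le> p (x + x0) - p x0" for x using lower[of 1 x] by (simp add: g_def)
  ultimately show ?thesis unfolding sublinear_def by blast
qed

text \<open>Zorn's lemma: a chain is bounded below pointwise by \<open>- p (- x)\<close>, and its infimum is subadditive because
  any two of its members are comparable.\<close>

lemma minimal_sublinear_exists:
  fixes p :: "'a::real_vector \<Rightarrow> real"
  assumes p: "sublinear p"
  shows "\<exists>m. sublinear m \<and> m \<le> p \<and> (\<forall>q. sublinear q \<longrightarrow> q \<le> m \<longrightarrow> q = m)"
proof -
  define S where "S = {q. sublinear q \<and> q \<le> p}"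
  have "\<exists>m\<in>S. \<forall>a\<in>S. a \<le> m \<longrightarrow> a = m"
  proof (rule predicate_Zorn)
    show "partial_order_on S (relation_of (\<lambda>m a. a \<le> m) S)"
      by (auto simp: partial_order_on_def preorder_on_def refl_on_def trans_def antisym_def relation_of_def)
  next
    fix C assume C: "C \<in> Chains (relation_of (\<lambda>m a. a \<le> m) S)"
    then have CS: "C \<subseteq> S" and tot: "\<And>a b. a \<in> C \<Longrightarrow> b \<in> C \<Longrightarrow> a \<le> b \<or> b \<le> a"
      by (auto simp: Chains_def relation_of_def)
    show "\<exists>u\<in>S. \<forall>a\<in>C. u \<le> a"
    proof (cases "C = {}")
      case True
      then show ?thesis using p by (auto simp: S_def)
    next
      case False
      then obtain q0 where q0: "q0 \<in> C" by blast
      have sub: "sublinear a" "a \<le> p" if "a \<in> C" for a using that CS by (auto simp: S_def)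
      define u where "u x = (INF a\<in>C. a x)" for x
      have "- p (- x) \<le> a x" if "a \<in> C" for a x
      proof -
        have "a (- x) \<le> p (- x)" using sub(2)[OF that] by (simp add: le_fun_def)
        then show ?thesis using sublinear_lower[OF sub(1)[OF that], of x] by linarith
      qed
      then have "bdd_below ((\<lambda>a. a x) ` C)" for x by (auto simp: bdd_below_def)
      then have lower: "u x \<le> a x" if "a \<in> C" for a x
        unfolding u_def using that by (intro cINF_lower) auto
      have greatest: "m \<le> u x" if "\<And>a. a \<in> C \<Longrightarrow> m \<le> a x" for m x
        unfolding u_def using that False by (intro cINF_greatest) auto
      have "u (x + y) \<le> u x + u y" for x y
      proof -
        have "u (x + y) \<le> a x + b y" if "a \<in> C" "b \<in> C" for a b
        proof (cases "a \<le> b")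
          case True
          have "u (x + y) \<le> a x + a y"
            using lower[OF that(1), of "x + y"] sublinear_add[OF sub(1)[OF that(1)], of x y] by linarith
          then show ?thesis using True by (simp add: le_fun_def) (meson add_left_mono order_trans)
        next
          case False
          then have "b \<le> a" using tot that by blast
          have "u (x + y) \<le> b x + b y"
            using lower[OF that(2), of "x + y"] sublinear_add[OF sub(1)[OF that(2)], of x y] by linarith
          moreover have "b x \<le> a x" using \<open>b \<le> a\<close> by (simp add: le_fun_def)
          ultimately show ?thesis by linarith
        qed
        then have "u (x + y) - a x \<le> u y" if "a \<in> C" for a
          using that by (intro greatest) (metis add.commute diff_le_eq)
        then have "u (x + y) - u y \<le> u x"
          by (intro greatest) (simp add: algebra_simps)
        then show ?thesis by simp
      qed
      moreover have "u (c *\<^sub>R x) \<le> c * u x" if "0 < c" for c x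
      proof -
        have "u (c *\<^sub>R x) / c \<le> u x"
        proof (rule greatest)
          fix a assume "a \<in> C"
          have "u (c *\<^sub>R x) \<le> c * a x"
            using lower[OF \<open>a \<in> C\<close>, of "c *\<^sub>R x"] sublinear_scale[OF sub(1)[OF \<open>a \<in> C\<close>], of c x] that by simp
          then show "u (c *\<^sub>R x) / c \<le> a x" using that by (simp add: field_simps)
        qed
        then show ?thesis using that by (simp add: field_simps)
      qed
      ultimately have "sublinear u" by (simp add: sublinear_def)
      moreover have "u \<le> a" if "a \<in> C" for a using lower[OF that] by (simp add: le_fun_def)
      moreover from this have "u \<le> p" using q0 sub(2) order_trans by blast
      ultimately show ?thesis by (auto simp: S_def)
    qed
  qed
  then obtain m where "m \<in> S" "\<And>a. a \<in> S \<Longrightarrow> a \<le> m \<Longrightarrow> a = m" by blast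
  then show ?thesis unfolding S_def by (metis (mono_tags, lifting) mem_Collect_eq order_trans)
qed

text \<open>A minimal sublinear function is linear, since \<open>sublinear_descend\<close> cannot lower it any further.
  Starting below the function that \<open>sublinear_descend\<close> provides at \<open>x0\<close> forces equality there.\<close>

theorem hahn_banach_sublinear:
  fixes p :: "'a::real_vector \<Rightarrow> real"
  assumes p: "sublinear p"
  shows "\<exists>u. linear u \<and> (\<forall>x. u x \<le> p x) \<and> u x0 = p x0"
proof -
  obtain q where q: "sublinear q" "q \<le> p" "\<And>x. q x \<le> p (x + x0) - p x0"
    using sublinear_descend[OF p] by blast
  obtain m where m: "sublinear m" "m \<le> q" and min: "\<And>r. sublinear r \<Longrightarrow> r \<le> m \<Longrightarrow> r = m"
    using minimal_sublinear_exists[OF q(1)] by blast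
  have add: "m (x + y) = m x + m y" for x y
  proof -
    obtain r where r: "sublinear r" "r \<le> m" "\<And>x. r x \<le> m (x + y) - m y"
      using sublinear_descend[OF m(1)] by blast
    have "m x \<le> m (x + y) - m y" using r(3)[of x] min[OF r(1,2)] by simp
    then show ?thesis using sublinear_add[OF m(1), of x y] by linarith
  qed
  have neg: "m (- x) = - m x" for x
    using add[of x "- x"] sublinear_zero[OF m(1)] by simp
  have scale: "m (t *\<^sub>R x) = t * m x" for t x
  proof (cases "t \<ge> 0")
    case True
    then show ?thesis by (rule sublinear_scale[OF m(1)])
  next
    case False
    then show ?thesis using sublinear_scale[OF m(1), of "- t" x] neg[of "t *\<^sub>R x"] by simp
  qed
  have le: "m x \<le> p x" for x using m(2) q(2) by (meson le_funD order_trans)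
  have "m (- x0) \<le> q (- x0)" using m(2) by (simp add: le_fun_def)
  also have "\<dots> \<le> - p x0" using q(3)[of "- x0"] sublinear_zero[OF p] by simp
  finally have "m x0 = p x0" using neg[of x0] le[of x0] by simp
  moreover have "linear m" by (rule linearI) (simp_all add: add scale)
  ultimately show ?thesis using le by blast
qed

lemma norming_functional:
  fixes x0 :: "'a::real_normed_vector"
  shows "\<exists>u. bounded_linear u \<and> (\<forall>x. \<bar>u x\<bar> \<le> norm x) \<and> u x0 = norm x0"
proof -
  have "sublinear (norm :: 'a \<Rightarrow> real)"
    by (simp add: sublinear_def norm_triangle_ineq)
  from hahn_banach_sublinear[OF this, of x0]
  obtain u where u: "linear u" "\<And>x. u x \<le> norm x" "u x0 = norm x0" by blast
  have "\<bar>u x\<bar> \<le> norm x" for x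
    using u(2)[of x] u(2)[of "- x"] linear_neg[OF u(1), of x] by simp
  moreover from this have "bounded_linear u"
    by (intro bounded_linear_intro[where K = 1]) (simp_all add: linear_add[OF u(1)] linear_scale[OF u(1)])
  ultimately show ?thesis using u(3) by blast
qed

text \<open>The Hahn--Banach theorem for the distance to \<open>Y\<close>.\<close>

lemma separate_point_closed_subspace:
  fixes z :: "'a::real_normed_vector"
  assumes Y: "subspace Y" and z: "z \<notin> closure Y"
  shows "\<exists>u :: 'a \<Rightarrow> real. bounded_linear u \<and> (\<forall>y\<in>Y. u y = 0) \<and> u z \<noteq> 0"
proof -
  have ne: "Y \<noteq> {}" using subspace_0[OF Y] by blast
  define p where "p x = infdist x Y" for x
  have lower: "p x \<le> norm (x - y)" if "y \<in> Y" for x y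
    unfolding p_def using infdist_le[OF that, of x] by (simp add: dist_norm)
  have greatest: "m \<le> p x" if "\<And>y. y \<in> Y \<Longrightarrow> m \<le> norm (x - y)" for m x
    unfolding p_def infdist_notempty[OF ne] using that ne by (intro cINF_greatest) (auto simp: dist_norm)
  have "sublinear p"
    unfolding sublinear_def
  proof (intro conjI allI impI)
    fix x y
    have "p (x + y) \<le> norm (x - a) + norm (y - b)" if "a \<in> Y" "b \<in> Y" for a b
      using lower[OF subspace_add[OF Y that], of "x + y"] norm_triangle_ineq[of "x - a" "y - b"]
      by (simp add: algebra_simps)
    then have "p (x + y) - norm (x - a) \<le> p y" if "a \<in> Y" for a
      using that by (intro greatest) (simp add: diff_le_eq add.commute)
    then have "p (x + y) - p y \<le> p x"
      by (intro greatest) (simp add: algebra_simps)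
    then show "p (x + y) \<le> p x + p y" by simp
  next
    fix t :: real and x assume t: "0 < t"
    have "p (t *\<^sub>R x) / t \<le> p x"
    proof (rule greatest)
      fix y assume "y \<in> Y"
      have "p (t *\<^sub>R x) \<le> norm (t *\<^sub>R x - t *\<^sub>R y)"
        by (rule lower[OF subspace_scale[OF Y \<open>y \<in> Y\<close>]])
      also have "\<dots> = t * norm (x - y)" using t by (simp flip: scaleR_diff_right)
      finally show "p (t *\<^sub>R x) / t \<le> norm (x - y)" using t by (simp add: field_simps)
    qed
    then show "p (t *\<^sub>R x) \<le> t * p x" using t by (simp add: field_simps)
  qed
  from hahn_banach_sublinear[OF this, of z]
  obtain u where u: "linear u" "\<And>x. u x \<le> p x" "u z = p z" by blast
  have p_norm: "p x \<le> norm x" for x using lower[OF subspace_0[OF Y], of x] by simp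
  have "\<bar>u x\<bar> \<le> norm x" for x
    using u(2)[of x] u(2)[of "- x"] linear_neg[OF u(1), of x] p_norm[of x] p_norm[of "- x"] by simp
  then have "bounded_linear u"
    by (intro bounded_linear_intro[where K = 1]) (simp_all add: linear_add[OF u(1)] linear_scale[OF u(1)])
  moreover have "u y = 0" if "y \<in> Y" for y
    using u(2)[of y] u(2)[of "- y"] linear_neg[OF u(1), of y] lower[OF that, of y]
      lower[OF subspace_neg[OF Y that], of "- y"] by simp
  moreover have "u z \<noteq> 0"
    using z ne by (simp add: u(3) p_def in_closure_iff_infdist_zero)
  ultimately show ?thesis by (intro exI[of _ u]) simp
qed

text \<open>Baire's theorem in the complete space of real functionals gives a ball of functionals that is uniformly
  bounded on \<open>T\<close>; norming functionals turn this into a bound for the norms.\<close>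

lemma weakly_bounded_imp_bounded:
  fixes T :: "'a::real_normed_vector set"
  assumes wb: "\<And>u. bounded_linear u \<Longrightarrow> \<exists>M::real. \<forall>t\<in>T. \<bar>u t\<bar> \<le> M"
  shows "bounded T"
proof -
  define C :: "nat \<Rightarrow> ('a \<Rightarrow>\<^sub>L real) set" where "C n = {f. \<forall>t\<in>T. \<bar>blinfun_apply f t\<bar> \<le> real n}" for n
  have "\<exists>n. f \<in> C n" for f
  proof -
    obtain M where M: "\<And>t. t \<in> T \<Longrightarrow> \<bar>blinfun_apply f t\<bar> \<le> M"
      using wb[OF blinfun.bounded_linear_right, of f] by blast
    then show ?thesis unfolding C_def
      by (auto intro!: exI[of _ "nat \<lceil>M\<rceil>"]) (meson real_nat_ceiling_ge order_trans)
  qed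
  then have UN: "\<Union>(range C) = UNIV" by blast
  have closed: "closed (C n)" for n
  proof -
    have "C n = (\<Inter>t\<in>T. {f. \<bar>blinfun_apply f t\<bar> \<le> real n})" by (auto simp: C_def)
    also have "closed \<dots>"
      by (intro closed_INT ballI closed_Collect_le continuous_intros)
    finally show ?thesis .
  qed
  have "\<exists>n. interior (C n) \<noteq> {}"
  proof (rule ccontr)
    assume "\<nexists>n. interior (C n) \<noteq> {}"
    then have "Met_TC.mtopology interior_of \<Union>(range C) = {}"
      by (intro Met_TC.metric_Baire_category_alt)
        (auto simp: closed complete_UNIV mtopology_is_euclidean)
    then show False by (simp add: UN mtopology_is_euclidean)
  qed
  then obtain n f r where r: "0 < r" "ball f r \<subseteq> C n"
    by (meson equals0I mem_interior)
  have "norm t \<le> 4 * real n / r" if t: "t \<in> T" for t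
  proof -
    obtain u where u: "bounded_linear u" "\<And>x. \<bar>u x\<bar> \<le> norm x" "u t = norm t"
      using norming_functional[of t] by blast
    \<comment> \<open>A step of half the radius keeps the norming functional inside the ball.\<close>
    define v where "v = (r / 2) *\<^sub>R Blinfun u"
    have "norm (Blinfun u) \<le> 1"
      using u by (intro norm_blinfun_bound) (simp_all add: bounded_linear_Blinfun_apply)
    then have "norm v < r" using mult_left_mono[of "norm (Blinfun u)" 1 "r / 2"] r(1) by (simp add: v_def)
    then have "f + v \<in> C n" "f \<in> C n" using r by (auto simp: subset_eq dist_norm)
    then have "\<bar>f t + (r / 2) * norm t\<bar> \<le> real n" "\<bar>f t\<bar> \<le> real n"
      using t u by (auto simp: C_def v_def bounded_linear_Blinfun_apply blinfun.bilinear_simps)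
    then have "(r / 2) * norm t \<le> 2 * real n" by linarith
    then show ?thesis using r(1) by (simp add: field_simps)
  qed
  then show ?thesis by (auto simp: bounded_iff)
qed

section \<open>Duals over the scalar field and the weak topology\<close>

lemma dual_scale: "f \<in> dual sE \<Longrightarrow> f (sE c x) = c * f x"
  and dual_add: "f \<in> dual sE \<Longrightarrow> f (x + y) = f x + f y"
  and dual_continuous: "f \<in> dual sE \<Longrightarrow> continuous_on UNIV f"
  by (simp_all add: dual_def Vector_Spaces.linear_iff)

lemma dual_bounded_linear:
  assumes B: "banach_space_over sE" and f: "f \<in> dual sE"
  shows "bounded_linear f"
proof -
  have scale: "f (r *\<^sub>R x) = r *\<^sub>R f x" for r x
    using dual_scale[OF f, of "of_real r" x] banach_space_over.scale_of_real[OF B, of r x]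
    by (simp add: scaleR_conv_of_real)
  obtain C where "\<And>x. norm (f x) \<le> C * norm x"
    using homogeneous_norm_bound[of f 1] scale dual_continuous[OF f] by auto
  then show ?thesis
    by (intro bounded_linear_intro[where K = C]) (simp_all add: dual_add[OF f] scale mult.commute)
qed

lemma dual_real_combination_bound:
  assumes B: "banach_space_over sE" and f: "f \<in> dual sE"
    and a: "\<And>i. \<bar>a i\<bar> \<le> K"
  shows "norm (f (\<Sum>i\<in>I. a i *\<^sub>R x i)) \<le> K * (\<Sum>i\<in>I. norm (f (x i)))"
proof -
  interpret f: bounded_linear f by (rule dual_bounded_linear[OF B f])
  have "norm (f (\<Sum>i\<in>I. a i *\<^sub>R x i)) \<le> (\<Sum>i\<in>I. norm (a i *\<^sub>R f (x i)))"
    unfolding f.sum f.scaleR by (rule norm_sum)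
  also have "\<dots> \<le> (\<Sum>i\<in>I. K * norm (f (x i)))"
    by (intro sum_mono) (simp add: a mult_right_mono)
  finally show ?thesis by (simp add: sum_distrib_left)
qed

text \<open>Over the complex scalars, \<open>u\<close> is the real part of the complex linear form \<open>u x - u (i x) i\<close>. Hence real
  functionals see no more than the dual does, and tests against the dual may be replaced by tests
  against real functionals.\<close>

lemma real_functional_factors_through_dual:
  fixes sE :: "'k::real_or_complex \<Rightarrow> 'e::banach \<Rightarrow> 'e" and u :: "'e \<Rightarrow> real"
  assumes B: "banach_space_over sE" and u: "bounded_linear u"
  shows "\<exists>f\<in>dual sE. \<exists>\<rho>. bounded_linear \<rho> \<and> (\<forall>x. u x = \<rho> (f x))"
proof -
  interpret E: banach_space_over sE by (rule B)
  interpret u: bounded_linear u by (rule u)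
  have lin: "Vector_Spaces.linear sE (*) f"
    if "\<And>x y. f (x + y) = f x + f y" "\<And>c x. f (sE c x) = c * f x" for f :: "'e \<Rightarrow> 'k"
    using that by (auto simp: Vector_Spaces.linear_iff E.vector_space_axioms vector_space_over_itself.vector_space_axioms)
  show ?thesis
    using real_or_complex[where 'a = 'k]
  proof
    assume R: "\<forall>z::'k. \<exists>a. z = a *\<^sub>R 1"
    define \<rho> :: "'k \<Rightarrow> real" where "\<rho> z = (SOME a. z = a *\<^sub>R 1)" for z
    have \<rho>: "\<rho> z *\<^sub>R 1 = z" for z unfolding \<rho>_def using R by (metis (mono_tags, lifting) someI)
    have \<rho>_of_real: "\<rho> (of_real a) = a" for a
      using \<rho>[of "of_real a"] by (simp flip: of_real_def)
    have zof: "of_real (\<rho> z) = z" for z using \<rho>[of z] by (simp add: of_real_def)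
    have "bounded_linear \<rho>"
    proof (rule bounded_linear_intro[where K = 1])
      show "\<rho> (x + y) = \<rho> x + \<rho> y" for x y by (metis \<rho>_of_real zof of_real_add)
      show "\<rho> (r *\<^sub>R x) = r *\<^sub>R \<rho> x" for r x
        by (metis \<rho>_of_real zof of_real_mult scaleR_conv_of_real real_scaleR_def)
      show "norm (\<rho> x) \<le> norm x * 1" for x
        by (metis zof norm_of_real mult.right_neutral real_norm_def order_refl)
    qed
    moreover define f :: "'e \<Rightarrow> 'k" where "f x = of_real (u x)" for x
    have "f (sE c x) = c * f x" for c x
    proof -
      have "sE c x = \<rho> c *\<^sub>R x" by (metis zof E.scale_of_real)
      then show ?thesis by (simp add: f_def u.scaleR zof)
    qed
    then have "f \<in> dual sE"
      by (auto simp: dual_def f_def u.add intro!: lin continuous_intros u.continuous_on)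
    moreover have "u x = \<rho> (f x)" for x by (simp add: f_def \<rho>_of_real)
    ultimately show ?thesis by blast
  next
    assume "\<exists>i::'k. i * i = - 1 \<and>
        (\<forall>z. \<exists>a b. z = a *\<^sub>R 1 + b *\<^sub>R i \<and> norm z = sqrt (a\<^sup>2 + b\<^sup>2))"
    then obtain i :: 'k where i: "i * i = - 1"
      and rep: "\<And>z. \<exists>a b. z = of_real a + of_real b * i \<and> norm z = sqrt (a\<^sup>2 + b\<^sup>2)"
      by (auto simp: of_real_def)
    have uniq0: "a = 0 \<and> b = 0" if "of_real a + of_real b * i = 0" for a b
    proof (cases "b = 0")
      case True
      with that show ?thesis by simp
    next
      case False
      have "of_real b * i = of_real (- a)" using that by (simp add: eq_neg_iff_add_eq_0 add.commute)
      then have "i = of_real (- a / b)" using False by (simp add: field_simps)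
      then have "of_real ((- a / b) * (- a / b)) = (of_real (- 1) :: 'k)"
        using i by (metis of_real_mult of_real_minus of_real_1)
      then have "(- a / b) * (- a / b) = - 1" by (simp only: of_real_eq_iff)
      then show ?thesis using zero_le_square[of "- a / b"] by linarith
    qed
    have uniq: "a = c" if "of_real a + of_real b * i = of_real c + of_real d * i" for a b c d
      using uniq0[of "a - c" "b - d"] that by (simp add: algebra_simps)
    define \<rho> :: "'k \<Rightarrow> real" where "\<rho> z = (SOME a. \<exists>b. z = of_real a + of_real b * i)" for z
    have \<rho>: "\<exists>b. z = of_real (\<rho> z) + of_real b * i" for z
      unfolding \<rho>_def by (rule someI_ex) (use rep[of z] in blast)
    have \<rho>_eq: "\<rho> (of_real a + of_real b * i) = a" for a b
      using \<rho>[of "of_real a + of_real b * i"] uniq by metis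
    have \<rho>_linear: "bounded_linear \<rho>"
    proof (rule bounded_linear_intro[where K = 1])
      fix x y :: 'k and r :: real
      obtain a b where x: "x = of_real a + of_real b * i" "norm x = sqrt (a\<^sup>2 + b\<^sup>2)" using rep[of x] by blast
      obtain c d where y: "y = of_real c + of_real d * i" using rep[of y] by blast
      have "x + y = of_real (a + c) + of_real (b + d) * i" by (simp add: x(1) y algebra_simps)
      then show "\<rho> (x + y) = \<rho> x + \<rho> y" by (simp only: x(1) y \<rho>_eq)
      have "r *\<^sub>R x = of_real (r * a) + of_real (r * b) * i"
        by (simp add: x(1) algebra_simps scaleR_conv_of_real)
      then show "\<rho> (r *\<^sub>R x) = r *\<^sub>R \<rho> x" by (simp only: x(1) \<rho>_eq real_scaleR_def)
      have "\<bar>a\<bar> \<le> norm x" by (simp add: x(2))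
      then show "norm (\<rho> x) \<le> norm x * 1" using x(1) by (simp add: \<rho>_eq)
    qed
    define J where "J = sE i"
    have J: "bounded_linear J"
    proof (rule bounded_linear_intro[where K = "norm i"])
      show "J (x + y) = J x + J y" for x y by (simp add: J_def E.scale_right_distrib)
      show "J (r *\<^sub>R x) = r *\<^sub>R J x" for r x
        unfolding J_def by (metis E.scale_of_real E.scale_left_commute)
      show "norm (J x) \<le> norm x * norm i" for x by (simp add: J_def E.norm_scale mult.commute)
    qed
    interpret J: bounded_linear J by (rule J)
    have JJ: "J (J x) = - x" for x
      by (simp add: J_def i)
    define f :: "'e \<Rightarrow> 'k" where "f x = of_real (u x) + of_real (- u (J x)) * i" for x
    have "f (sE c x) = c * f x" for c x
    proof -
      obtain a b where c: "c = of_real a + of_real b * i" using rep[of c] by blast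
      have "sE c x = a *\<^sub>R x + b *\<^sub>R J x"
        by (simp add: c E.scale_left_distrib J_def E.scale_of_real flip: E.scale_scale)
      then have "u (sE c x) = a * u x + b * u (J x)" and "u (J (sE c x)) = a * u (J x) - b * u x"
        by (simp_all add: u.add u.diff u.scaleR J.add J.scaleR JJ)
      then have "f (sE c x) = of_real a * of_real (u x) + of_real b * of_real (u (J x))
          - of_real a * of_real (u (J x)) * i + of_real b * of_real (u x) * i"
        unfolding f_def by (simp only: of_real_add of_real_diff of_real_minus of_real_mult) (simp add: algebra_simps)
      moreover have "c * f x = of_real a * of_real (u x) - of_real a * of_real (u (J x)) * i
          + of_real b * of_real (u x) * i - of_real b * of_real (u (J x)) * (i * i)"
        by (simp add: c f_def algebra_simps)
      ultimately show ?thesis by (simp add: i)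
    qed
    moreover have "f (x + y) = f x + f y" for x y
      by (simp add: f_def u.add J.add algebra_simps)
    ultimately have "f \<in> dual sE"
      by (auto simp: dual_def f_def intro!: lin continuous_intros u.continuous_on J.continuous_on)
    moreover have "u x = \<rho> (f x)" for x by (simp only: f_def \<rho>_eq)
    ultimately show ?thesis using \<rho>_linear by blast
  qed
qed

text \<open>The scalar class does not assert completeness; it is inherited from the real coordinates.\<close>

lemma real_or_complex_summable_norm_cancel:
  fixes a :: "nat \<Rightarrow> 'k::real_or_complex"
  assumes "summable (\<lambda>n. norm (a n))"
  shows "summable a"
proof -
  have "\<exists>i::'k. \<forall>z. \<exists>b c. z = of_real b + of_real c * i \<and> \<bar>b\<bar> \<le> norm z \<and> \<bar>c\<bar> \<le> norm z"
    using real_or_complex[where 'a = 'k]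
  proof
    assume R: "\<forall>z::'k. \<exists>a. z = a *\<^sub>R 1"
    have "\<exists>b c. z = of_real b + of_real c * 0 \<and> \<bar>b\<bar> \<le> norm z \<and> \<bar>c\<bar> \<le> norm z" for z :: 'k
    proof -
      obtain b where "z = b *\<^sub>R 1" using R by blast
      then show ?thesis by (intro exI[of _ b] exI[of _ 0]) (simp add: of_real_def)
    qed
    then show ?thesis by blast
  next
    assume "\<exists>i::'k. i * i = - 1 \<and>
        (\<forall>z. \<exists>a b. z = a *\<^sub>R 1 + b *\<^sub>R i \<and> norm z = sqrt (a\<^sup>2 + b\<^sup>2))"
    then obtain i :: 'k where i: "\<And>z. \<exists>a b. z = a *\<^sub>R 1 + b *\<^sub>R i \<and> norm z = sqrt (a\<^sup>2 + b\<^sup>2)" by blast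
    have "\<exists>b c. z = of_real b + of_real c * i \<and> \<bar>b\<bar> \<le> norm z \<and> \<bar>c\<bar> \<le> norm z" for z
    proof -
      obtain b c where "z = b *\<^sub>R 1 + c *\<^sub>R i" "norm z = sqrt (b\<^sup>2 + c\<^sup>2)" using i by blast
      then show ?thesis by (intro exI[of _ b] exI[of _ c]) (simp add: scaleR_conv_of_real)
    qed
    then show ?thesis by blast
  qed
  then obtain i b c where eq: "\<And>z::'k. z = of_real (b z) + of_real (c z) * i"
    and le: "\<And>z::'k. \<bar>b z\<bar> \<le> norm z" "\<And>z::'k. \<bar>c z\<bar> \<le> norm z" by metis
  have "summable (\<lambda>n. b (a n))" "summable (\<lambda>n. c (a n))"
    by (rule summable_comparison_test'[OF assms, of 0]; simp add: le)+
  then have "summable (\<lambda>n. of_real (b (a n)) + of_real (c (a n)) * i)"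
    by (intro summable_add summable_mult2 summable_of_real)
  then show ?thesis by (simp flip: eq)
qed

lemma weak_topology_topspace:
  assumes B: "banach_space_over sE"
  shows "topspace (weak_topology sE) = UNIV"
proof -
  have "(\<lambda>_. 0) \<in> dual sE"
    by (simp add: dual_def Vector_Spaces.linear_iff banach_space_over.axioms(1)[OF B]
        vector_space_over_itself.vector_space_axioms)
  then have "(\<lambda>_. 0) -` UNIV \<in> {f -` U | f U. f \<in> dual sE \<and> open U}" by blast
  then show ?thesis
    unfolding weak_topology_def topology_generated_by_topspace by blast
qed

lemma weak_topology_continuous_functional:
  fixes sF :: "'k::real_or_complex \<Rightarrow> 'f::banach \<Rightarrow> 'f"
  assumes B: "banach_space_over sF" and u: "bounded_linear (u :: 'f \<Rightarrow> real)"
  shows "continuous_map (weak_topology sF) euclideanreal u"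
proof -
  obtain f \<rho> where f: "f \<in> dual sF" and \<rho>: "bounded_linear \<rho>" and u_eq: "\<And>x. u x = \<rho> (f x)"
    using real_functional_factors_through_dual[OF B u] by blast
  have "continuous_map (weak_topology sF) euclidean f"
    unfolding continuous_map_def
  proof (intro conjI allI impI)
    fix U :: "'k set" assume "openin euclidean U"
    then have "openin (weak_topology sF) (f -` U)"
      unfolding weak_topology_def by (intro topology_generated_by_Basis) (use f in auto)
    then show "openin (weak_topology sF) {x \<in> topspace (weak_topology sF). f x \<in> U}"
      by (simp add: weak_topology_topspace[OF B] vimage_def)
  qed simp
  moreover have "continuous_map euclidean euclideanreal \<rho>"
    using linear_continuous_on[OF \<rho>] by simp
  ultimately have "continuous_map (weak_topology sF) euclideanreal (\<rho> \<circ> f)"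
    by (rule continuous_map_compose)
  then show ?thesis by (simp add: o_def flip: u_eq)
qed

lemma weakly_null_limitin:
  assumes B: "banach_space_over sE" and y: "weakly_null sE y"
  shows "limitin (weak_topology sE) y 0 sequentially"
proof -
  let ?S = "{f -` U | f U. f \<in> dual sE \<and> open U}"
  have "0 \<in> topspace (weak_topology sE)" by (simp add: weak_topology_topspace[OF B])
  moreover have "\<forall>\<^sub>F n in sequentially. y n \<in> U" if "generate_topology_on ?S U" "0 \<in> U" for U
    using that
  proof (induction rule: generate_topology_on.induct)
    case Empty
    then show ?case by simp
  next
    case (Int a b)
    then show ?case by (simp add: eventually_conj)
  next
    case (UN K)
    then obtain V where "V \<in> K" "0 \<in> V" by blast
    with UN have "\<forall>\<^sub>F n in sequentially. y n \<in> V" by blast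
    then show ?case by (rule eventually_mono) (use \<open>V \<in> K\<close> in blast)
  next
    case (Basis s)
    then obtain f U where f: "s = f -` U" "f \<in> dual sE" "open U" by blast
    have "f 0 = 0" using dual_add[OF f(2), of 0 0] by simp
    then have "0 \<in> U" using Basis f(1) by simp
    moreover have "(\<lambda>n. f (y n)) \<longlonglongrightarrow> 0" using y f(2) by (simp add: weakly_null_def)
    ultimately show ?case using topological_tendstoD[OF _ f(3)] f(1) by fastforce
  qed
  ultimately show ?thesis
    by (simp add: limitin_def weak_topology_def openin_topology_generated_by_iff)
qed

text \<open>The point lies in the weak closure of every tail of \<open>v\<close>. The conclusion lists only what closed strips of
  real functionals see of it.\<close>

lemma weakly_compact_cluster_point:
  fixes sF :: "'k::real_or_complex \<Rightarrow> 'f::banach \<Rightarrow> 'f" and v :: "nat \<Rightarrow> 'f"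
  assumes B: "banach_space_over sF" and K: "rel_weakly_compact sF K" and v: "range v \<subseteq> K"
  shows "\<exists>z. \<forall>u c e. bounded_linear (u :: 'f \<Rightarrow> real) \<longrightarrow>
    (\<forall>\<^sub>F j in sequentially. \<bar>u (v j) - c\<bar> \<le> e) \<longrightarrow> \<bar>u z - c\<bar> \<le> e"
proof -
  let ?X = "weak_topology sF"
  define C where "C N = ?X closure_of (v ` {N..})" for N
  have top: "topspace ?X = UNIV" by (rule weak_topology_topspace[OF B])
  have vC: "v M \<in> C N" if "N \<le> M" for M N
    using closure_of_subset[of "v ` {N..}" ?X] that by (auto simp: C_def top)
  have vK: "v M \<in> ?X closure_of K" for M
    using closure_of_subset[of K ?X] v by (auto simp: top)
  have "(?X closure_of K) \<inter> \<Inter>\<F> \<noteq> {}" if \<F>: "finite \<F>" "\<F> \<subseteq> range C" for \<F>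
  proof -
    obtain J where J: "finite J" "\<F> = C ` J" using finite_subset_image[OF \<F>] by auto
    obtain M where "\<forall>N\<in>J. N \<le> M" using J(1) finite_nat_set_iff_bounded_le by blast
    then have "v M \<in> (?X closure_of K) \<inter> \<Inter>\<F>" using vC vK J(2) by auto
    then show ?thesis by blast
  qed
  moreover have "closedin ?X c" if "c \<in> range C" for c using that by (auto simp: C_def)
  moreover have "compactin ?X (?X closure_of K)" using K by (simp add: rel_weakly_compact_def)
  ultimately have "(?X closure_of K) \<inter> \<Inter>(range C) \<noteq> {}"
    unfolding compactin_fip by blast
  then obtain z where z: "\<And>N. z \<in> C N" by blast
  have "\<bar>u z - c\<bar> \<le> e" if u: "bounded_linear u" and ev: "\<forall>\<^sub>F j in sequentially. \<bar>u (v j) - c\<bar> \<le> e"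
    for u :: "'f \<Rightarrow> real" and c e
  proof -
    obtain N where N: "\<And>j. j \<ge> N \<Longrightarrow> \<bar>u (v j) - c\<bar> \<le> e" using ev by (auto simp: eventually_sequentially)
    have "closedin ?X {x \<in> topspace ?X. u x \<in> cball c e}"
      by (rule closedin_continuous_map_preimage[OF weak_topology_continuous_functional[OF B u]]) simp
    moreover have "v ` {N..} \<subseteq> {x \<in> topspace ?X. u x \<in> cball c e}"
      using N by (auto simp: top dist_real_def abs_minus_commute)
    ultimately have "C N \<subseteq> {x \<in> topspace ?X. u x \<in> cball c e}"
      unfolding C_def by (intro closure_of_minimal)
    then show ?thesis using z[of N] by (auto simp: dist_real_def abs_minus_commute)
  qed
  then show ?thesis by blast
qed

text \<open>Alaoglu's theorem by Tychonoff: the \<open>g n\<close> live in a product of compact intervals, and a cluster point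
  in the product topology inherits linearity and the norm bound.\<close>

lemma functionals_cluster_point:
  fixes g :: "nat \<Rightarrow> 'f::real_normed_vector \<Rightarrow> real"
  assumes lin: "\<And>n. linear (g n)" and bd: "\<And>n v. \<bar>g n v\<bar> \<le> norm v"
  shows "\<exists>h. bounded_linear h \<and> (\<forall>v. \<bar>h v\<bar> \<le> norm v) \<and> (\<forall>V e. finite V \<longrightarrow> 0 < e \<longrightarrow>
    (\<exists>\<^sub>F n in sequentially. \<forall>v\<in>V. \<bar>g n v - h v\<bar> < e))"
proof -
  define U :: "('f \<Rightarrow> real) set" where "U = (\<Pi>\<^sub>E v\<in>UNIV. {- norm v..norm v})"
  have "compactin (product_topology (\<lambda>_. euclideanreal) UNIV) U"
    unfolding U_def compactin_PiE by simp
  then have "compact U" by (simp add: euclidean_product_topology)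
  moreover have "\<forall>\<^sub>F f in filtermap g sequentially. f \<in> U"
    using bd by (simp add: eventually_filtermap U_def PiE_def Pi_def abs_le_iff minus_le_iff)
  moreover have "filtermap g sequentially \<noteq> bot" by (simp add: filtermap_bot_iff)
  ultimately obtain h where h: "h \<in> U" "inf (nhds h) (filtermap g sequentially) \<noteq> bot"
    unfolding compact_filter by blast
  have freq: "\<exists>\<^sub>F n in sequentially. \<forall>v\<in>V. \<bar>g n v - h v\<bar> < e" if "finite V" "0 < e" for V e
  proof -
    have "open (\<Inter>v\<in>V. {f. \<bar>f v - h v\<bar> < e})"
      using that(1) by (intro open_INT ballI open_Collect_less continuous_intros continuous_on_product_coordinates)
    then have "\<forall>\<^sub>F f in nhds h. f \<in> (\<Inter>v\<in>V. {f. \<bar>f v - h v\<bar> < e})"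
      using that(2) by (intro eventually_nhds_in_open) auto
    then have ev: "\<forall>\<^sub>F f in nhds h. \<forall>v\<in>V. \<bar>f v - h v\<bar> < e" by simp
    show ?thesis
    proof (rule ccontr)
      assume "\<not> ?thesis"
      then have "\<forall>\<^sub>F f in filtermap g sequentially. \<not> (\<forall>v\<in>V. \<bar>f v - h v\<bar> < e)"
        by (simp only: not_frequently eventually_filtermap)
      with ev have "\<forall>\<^sub>F f in inf (nhds h) (filtermap g sequentially). False"
        unfolding eventually_inf by blast
      then show False using h(2) by (simp add: trivial_limit_def)
    qed
  qed
  have approx: "\<exists>n. \<forall>v\<in>V. \<bar>g n v - h v\<bar> < e" if "finite V" "0 < e" for V e
    using frequently_ex[OF freq[OF that]] by blast
  have "h (x + y) = h x + h y" for x y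
  proof -
    have "\<bar>h (x + y) - (h x + h y)\<bar> \<le> 0 + e" if e: "0 < e" for e
    proof -
      obtain n where "\<forall>v\<in>{x, y, x + y}. \<bar>g n v - h v\<bar> < e / 3"
        using approx[of "{x, y, x + y}" "e / 3"] e by auto
      then have "\<bar>g n x - h x\<bar> < e / 3" "\<bar>g n y - h y\<bar> < e / 3" "\<bar>g n (x + y) - h (x + y)\<bar> < e / 3"
        by auto
      then show ?thesis using linear_add[OF lin[of n], of x y] by linarith
    qed
    then have "\<bar>h (x + y) - (h x + h y)\<bar> \<le> 0" by (rule field_le_epsilon)
    then show ?thesis by simp
  qed
  moreover have "h (r *\<^sub>R x) = r *\<^sub>R h x" for r x
  proof -
    have "\<bar>h (r *\<^sub>R x) - r * h x\<bar> \<le> 0 + e" if e: "0 < e" for e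
    proof -
      \<comment> \<open>Chosen so that \<open>d + \<bar>r\<bar> d = e\<close>.\<close>
      define d where "d = e / (1 + \<bar>r\<bar>)"
      have "0 < d" using e by (simp add: d_def add_pos_nonneg)
      then obtain n where n: "\<bar>g n x - h x\<bar> < d" "\<bar>g n (r *\<^sub>R x) - h (r *\<^sub>R x)\<bar> < d"
        using approx[of "{x, r *\<^sub>R x}" d] by auto
      have "\<bar>r * g n x - r * h x\<bar> \<le> \<bar>r\<bar> * d"
        using n(1) by (simp add: mult_left_mono flip: abs_mult right_diff_distrib)
          (metis abs_ge_zero abs_mult less_imp_le mult_left_mono)
      moreover have "g n (r *\<^sub>R x) = r * g n x" using linear_scale[OF lin[of n], of r x] by simp
      moreover have "d + \<bar>r\<bar> * d = e"
      proof -
        have "1 + \<bar>r\<bar> \<noteq> 0" using abs_ge_zero[of r] by linarith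
        then have "(1 + \<bar>r\<bar>) * d = e" by (simp add: d_def)
        then show ?thesis by (simp add: distrib_right)
      qed
      ultimately show ?thesis using n(2) by linarith
    qed
    then have "\<bar>h (r *\<^sub>R x) - r * h x\<bar> \<le> 0" by (rule field_le_epsilon)
    then show ?thesis by simp
  qed
  moreover have h_le: "norm (h x) \<le> norm x * 1" for x
    using h(1) by (auto simp: U_def PiE_def Pi_def abs_le_iff minus_le_iff)
  ultimately have "bounded_linear h" by (rule bounded_linear_intro)
  then show ?thesis using freq h_le by auto
qed

section \<open>Series with bounded combinations\<close>

text \<open>The norm form of weak unconditional Cauchyness: for \<open>K = 1\<close> the combinations are the images of the
  finitely supported elements of the real unit ball of \<open>c\<^sub>0\<close> under the operator sending the \<open>i\<close>-th unit
  vector to \<open>x i\<close>, and their boundedness is the continuity of this operator. In this form the property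
  does not mention functionals.\<close>

definition bounded_combinations :: "(nat \<Rightarrow> 'e::real_normed_vector) \<Rightarrow> bool" where
  "bounded_combinations x \<longleftrightarrow> (\<forall>K. \<exists>C. \<forall>B a. finite B \<longrightarrow> (\<forall>i\<in>B. \<bar>a i\<bar> \<le> K) \<longrightarrow>
     norm (\<Sum>i\<in>B. a i *\<^sub>R x i) \<le> C)"

lemma bounded_combinations_scaleR:
  assumes "bounded_combinations y"
  shows "bounded_combinations (\<lambda>n. t *\<^sub>R y n)"
  unfolding bounded_combinations_def
proof
  fix K
  obtain C where C: "\<And>B a. finite B \<Longrightarrow> (\<forall>i\<in>B. \<bar>a i\<bar> \<le> K * \<bar>t\<bar>) \<Longrightarrow> norm (\<Sum>i\<in>B. a i *\<^sub>R y i) \<le> C"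
    using assms unfolding bounded_combinations_def by blast
  have "norm (\<Sum>i\<in>B. a i *\<^sub>R t *\<^sub>R y i) \<le> C" if "finite B" "\<forall>i\<in>B. \<bar>a i\<bar> \<le> K" for B a
    using C[of B "\<lambda>i. a i * t"] that by (simp add: abs_mult mult_right_mono)
  then show "\<exists>C. \<forall>B a. finite B \<longrightarrow> (\<forall>i\<in>B. \<bar>a i\<bar> \<le> K) \<longrightarrow> norm (\<Sum>i\<in>B. a i *\<^sub>R t *\<^sub>R y i) \<le> C"
    by blast
qed

lemma wuC_bounded_combinations:
  fixes sE :: "'k::real_or_complex \<Rightarrow> 'e::banach \<Rightarrow> 'e"
  assumes B: "banach_space_over sE" and x: "wuC sE x"
  shows "bounded_combinations x"
  unfolding bounded_combinations_def
proof
  fix K :: real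
  define T where "T = {\<Sum>i\<in>B. a i *\<^sub>R x i | B a. finite B \<and> (\<forall>i\<in>B. \<bar>a i\<bar> \<le> K)}"
  have "bounded T"
  proof (rule weakly_bounded_imp_bounded)
    fix u :: "'e \<Rightarrow> real" assume u: "bounded_linear u"
    interpret u: bounded_linear u by (rule u)
    obtain f \<rho> where f: "f \<in> dual sE" and \<rho>: "bounded_linear \<rho>" and eq: "\<And>x. u x = \<rho> (f x)"
      using real_functional_factors_through_dual[OF B u] by blast
    obtain C where C: "C > 0" "\<And>z. norm (\<rho> z) \<le> norm z * C"
      using bounded_linear.pos_bounded[OF \<rho>] by blast
    have sm: "summable (\<lambda>i. norm (f (x i)))" using x f by (simp add: wuC_def)
    have "\<bar>u t\<bar> \<le> \<bar>K\<bar> * (C * (\<Sum>i. norm (f (x i))))" if tT: "t \<in> T" for t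
    proof -
      obtain B a where t: "t = (\<Sum>i\<in>B. a i *\<^sub>R x i)" "finite B" "\<And>i. i \<in> B \<Longrightarrow> \<bar>a i\<bar> \<le> K"
        using tT unfolding T_def by blast
      have "\<bar>u t\<bar> \<le> (\<Sum>i\<in>B. \<bar>a i * u (x i)\<bar>)"
        by (simp add: t(1) u.sum u.scaleR)
      also have "\<dots> \<le> (\<Sum>i\<in>B. \<bar>K\<bar> * (C * norm (f (x i))))"
      proof (rule sum_mono)
        fix i assume "i \<in> B"
        then have "\<bar>a i\<bar> \<le> \<bar>K\<bar>" using t(3)[of i] by linarith
        moreover have "\<bar>u (x i)\<bar> \<le> C * norm (f (x i))"
          using C(2)[of "f (x i)"] by (simp add: eq mult.commute)
        ultimately show "\<bar>a i * u (x i)\<bar> \<le> \<bar>K\<bar> * (C * norm (f (x i)))"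
          unfolding abs_mult by (intro mult_mono) auto
      qed
      also have "\<dots> = \<bar>K\<bar> * (C * (\<Sum>i\<in>B. norm (f (x i))))"
        by (simp add: sum_distrib_left)
      also have "\<dots> \<le> \<bar>K\<bar> * (C * (\<Sum>i. norm (f (x i))))"
        using C(1) by (intro mult_left_mono sum_le_suminf sm t(2)) auto
      finally show ?thesis .
    qed
    then show "\<exists>M. \<forall>t\<in>T. \<bar>u t\<bar> \<le> M" by blast
  qed
  then obtain C where C: "\<And>t. t \<in> T \<Longrightarrow> norm t \<le> C" by (auto simp: bounded_iff)
  show "\<exists>C. \<forall>B a. finite B \<longrightarrow> (\<forall>i\<in>B. \<bar>a i\<bar> \<le> K) \<longrightarrow> norm (\<Sum>i\<in>B. a i *\<^sub>R x i) \<le> C"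
    by (intro exI[of _ C] allI impI C) (auto simp: T_def)
qed

lemma wuC_imp_weakly_null: "wuC sE y \<Longrightarrow> weakly_null sE y"
  unfolding wuC_def weakly_null_def by (blast intro: tendsto_norm_zero_cancel summable_LIMSEQ_zero)

section \<open>Scalar polynomials along such series\<close>

text \<open>If \<open>q (y n) \<ge> q 0 + e\<close> infinitely often, one can keep adding terms \<open>y n\<close> to a finite sum and gain at
  least \<open>e / 2\<close> each time, because by hypothesis the gain from adding a late \<open>y n\<close> to \<open>w\<close> is nearly
  \<open>q (y n) - q 0\<close>. The sums stay bounded and the values do not.\<close>

lemma upper_limit_along_bounded_combinations:
  fixes q :: "'e::real_normed_vector \<Rightarrow> real"
  assumes lim: "\<And>w. (\<lambda>n. q (w + y n) - q (y n)) \<longlonglongrightarrow> q w - q 0"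
    and bdd: "\<And>R. \<exists>M. \<forall>x. norm x \<le> R \<longrightarrow> \<bar>q x\<bar> \<le> M"
    and y: "bounded_combinations y" and e: "0 < e"
  shows "\<forall>\<^sub>F n in sequentially. q (y n) < q 0 + e"
proof (rule ccontr)
  assume "\<not> (\<forall>\<^sub>F n in sequentially. q (y n) < q 0 + e)"
  then have freq: "\<exists>\<^sub>F n in sequentially. q 0 + e \<le> q (y n)"
    by (simp add: frequently_def not_le)
  have grow: "\<exists>B. finite B \<and> q 0 + real N * (e / 2) \<le> q (\<Sum>i\<in>B. y i)" for N
  proof (induction N)
    case 0
    show ?case by (intro exI[of _ "{}"]) simp
  next
    case (Suc N)
    then obtain B where B: "finite B" "q 0 + real N * (e / 2) \<le> q (\<Sum>i\<in>B. y i)" by blast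
    define w where "w = (\<Sum>i\<in>B. y i)"
    have "\<forall>\<^sub>F n in sequentially. q w - q 0 - e / 2 < q (w + y n) - q (y n)"
      using e by (intro order_tendstoD(1)[OF lim]) simp
    moreover have "\<forall>\<^sub>F n in sequentially. n \<notin> B"
      using B(1) by (metis (no_types, lifting) eventually_cofinite cofinite_eq_sequentially finite_subset mem_Collect_eq subsetI)
    ultimately have "\<exists>\<^sub>F n in sequentially. q 0 + e \<le> q (y n) \<and> q w - q 0 - e / 2 < q (w + y n) - q (y n) \<and> n \<notin> B"
      using freq by (simp add: frequently_eventually_frequently eventually_conj)
    then obtain n where n: "q 0 + e \<le> q (y n)" "q w - q 0 - e / 2 < q (w + y n) - q (y n)" "n \<notin> B"
      by (auto dest: frequently_ex)
    have "(\<Sum>i\<in>insert n B. y i) = w + y n" using n(3) B(1) by (simp add: w_def)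
    moreover have "q 0 + real (Suc N) * (e / 2) \<le> q (w + y n)"
    proof -
      have "real (Suc N) * (e / 2) = real N * (e / 2) + e / 2" by (simp add: algebra_simps)
      then show ?thesis using n(1,2) B(2)[folded w_def] by linarith
    qed
    ultimately show ?case using B(1) by (intro exI[of _ "insert n B"]) simp
  qed
  obtain C where C: "\<And>B a. finite B \<Longrightarrow> (\<forall>i\<in>B. \<bar>a i\<bar> \<le> 1) \<Longrightarrow> norm (\<Sum>i\<in>B. a i *\<^sub>R y i) \<le> C"
    using y unfolding bounded_combinations_def by blast
  obtain M where M: "\<And>x. norm x \<le> C \<Longrightarrow> \<bar>q x\<bar> \<le> M" using bdd[of C] by blast
  obtain N where N: "(M - q 0) / (e / 2) < real N" using reals_Archimedean2 by blast
  then have "M < q 0 + real N * (e / 2)" using e by (simp add: field_simps)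
  moreover obtain B where B: "finite B" "q 0 + real N * (e / 2) \<le> q (\<Sum>i\<in>B. y i)" using grow by blast
  moreover have "norm (\<Sum>i\<in>B. y i) \<le> C" using C[OF B(1), of "\<lambda>_. 1"] by simp
  ultimately show False using M[of "\<Sum>i\<in>B. y i"] by linarith
qed

text \<open>Induction on the degree: the difference of \<open>q\<close> in direction \<open>w\<close> has lower degree, which reduces the claim to
  \<open>w = 0\<close>, and there the previous lemma applies to \<open>q\<close> and to \<open>- q\<close>.\<close>

lemma scalar_polynomial_tendsto:
  fixes q :: "'e::real_normed_vector \<Rightarrow> real"
  assumes "degree_le k q" and "\<And>R. \<exists>M. \<forall>x. norm x \<le> R \<longrightarrow> \<bar>q x\<bar> \<le> M"
    and y: "bounded_combinations y"
  shows "(\<lambda>n. q (w + y n)) \<longlonglongrightarrow> q w"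
  using assms(1,2)
proof (induction k arbitrary: q w)
  case 0
  then have "q (w + y n) = q w" for n by (intro degree_le_const)
  then show ?case by simp
next
  case (Suc k)
  have lim: "(\<lambda>n. q (v + y n) - q (y n)) \<longlonglongrightarrow> q v - q 0" for v
  proof -
    have "\<exists>M. \<forall>x. norm x \<le> R \<longrightarrow> \<bar>fwd_diff v q x\<bar> \<le> M" for R
    proof -
      obtain M1 where M1: "\<And>x. norm x \<le> R + norm v \<Longrightarrow> \<bar>q x\<bar> \<le> M1"
        using Suc.prems(2)[of "R + norm v"] by blast
      obtain M2 where M2: "\<And>x. norm x \<le> R \<Longrightarrow> \<bar>q x\<bar> \<le> M2"
        using Suc.prems(2)[of R] by blast
      have "\<bar>fwd_diff v q x\<bar> \<le> M1 + M2" if "norm x \<le> R" for x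
      proof -
        have "norm (x + v) \<le> R + norm v" using that norm_triangle_ineq[of x v] by linarith
        then show ?thesis using M1[of "x + v"] M2[OF that] by (simp add: fwd_diff_def)
      qed
      then show ?thesis by blast
    qed
    moreover have "degree_le k (fwd_diff v q)" using Suc.prems(1) by simp
    ultimately have "(\<lambda>n. fwd_diff v q (0 + y n)) \<longlonglongrightarrow> fwd_diff v q 0" by (intro Suc.IH)
    then show ?thesis by (simp add: fwd_diff_def add.commute)
  qed
  have "(\<lambda>n. q (y n)) \<longlonglongrightarrow> q 0"
  proof (rule order_tendstoI)
    fix a assume "q 0 < a"
    then show "\<forall>\<^sub>F n in sequentially. q (y n) < a"
      using upper_limit_along_bounded_combinations[OF lim Suc.prems(2) y, of "a - q 0"] by simp
  next
    fix a assume "a < q 0"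
    have "(\<lambda>n. - q (v + y n) - - q (y n)) \<longlonglongrightarrow> - q v - - q 0" for v
      using tendsto_minus[OF lim[of v]] by simp
    with \<open>a < q 0\<close> show "\<forall>\<^sub>F n in sequentially. a < q (y n)"
      using upper_limit_along_bounded_combinations[where q = "\<lambda>x. - q x" and e = "q 0 - a", OF _ _ y] Suc.prems(2)
      by simp
  qed
  from tendsto_add[OF lim[of w] this] show ?case by simp
qed

lemma hom_polys_functional_tendsto:
  fixes sE :: "'k::real_or_complex \<Rightarrow> 'e::banach \<Rightarrow> 'e" and sF :: "'k \<Rightarrow> 'f::banach \<Rightarrow> 'f"
  assumes E: "banach_space_over sE" and F: "banach_space_over sF"
    and k: "k \<ge> 1" and P: "P \<in> hom_polys sE sF k"
    and g: "bounded_linear (g :: 'f \<Rightarrow> real)" and y: "bounded_combinations y"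
  shows "(\<lambda>n. g (P (w + y n))) \<longlonglongrightarrow> g (P w)"
proof -
  interpret g: bounded_linear g by (rule g)
  have cont: "continuous_on UNIV P" using P by (simp add: hom_polys_def)
  obtain C where C: "C \<ge> 0" "\<And>x. norm (P x) \<le> C * norm x ^ k"
    using homogeneous_norm_bound[OF hom_polys_scaleR[OF E F P] cont k] by blast
  obtain D where D: "D \<ge> 0" "\<And>v. norm (g v) \<le> norm v * D" using g.nonneg_bounded by blast
  have "\<exists>M. \<forall>x. norm x \<le> R \<longrightarrow> \<bar>g (P x)\<bar> \<le> M" for R
  proof (intro exI allI impI)
    fix x :: 'e assume R: "norm x \<le> R"
    have "\<bar>g (P x)\<bar> \<le> norm (P x) * D" using D(2)[of "P x"] by simp
    also have "\<dots> \<le> (C * norm x ^ k) * D" by (intro mult_right_mono C D)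
    also have "\<dots> \<le> (C * R ^ k) * D" by (intro mult_right_mono mult_left_mono power_mono R C D) simp
    finally show "\<bar>g (P x)\<bar> \<le> (C * R ^ k) * D" .
  qed
  then show ?thesis
    using scalar_polynomial_tendsto[where q = "\<lambda>x. g (P x)", OF degree_le_compose_additive[OF g.diff hom_polys_degree_le[OF E F P]] _ y]
    by blast
qed

section \<open>Reduction to large values along a single series\<close>

text \<open>The \<open>y j\<close> are combinations of disjoint blocks of the subseries with coefficients at most \<open>k\<close>, so
  the absolute values of a functional on them are summable again.\<close>

lemma wuC_with_large_values:
  fixes sE :: "'k::real_or_complex \<Rightarrow> 'e::banach \<Rightarrow> 'e" and sF :: "'k \<Rightarrow> 'f::banach \<Rightarrow> 'f"
  assumes E: "banach_space_over sE" and F: "banach_space_over sF"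
    and k: "k \<ge> 1" and P: "P \<in> hom_polys sE sF k"
    and x: "wuC sE x" and nuc: "\<not> uc (\<lambda>i. P (x i))"
  shows "\<exists>y e. wuC sE y \<and> 0 < e \<and> (\<forall>n. e \<le> norm (P (y n)))"
proof -
  obtain r :: "nat \<Rightarrow> nat" where r: "strict_mono r" and ns: "\<not> summable (\<lambda>i. P (x (r i)))"
    using nuc by (auto simp: uc_def)
  define z where "z i = x (r i)" for i
  obtain e where e: "e > 0" "\<And>N. \<exists>m\<ge>N. \<exists>n. e \<le> norm (\<Sum>i=m..<n. P (z i))"
    using ns unfolding summable_Cauchy z_def by (meson not_le)
  have "\<exists>s. \<forall>j. e \<le> norm (\<Sum>i=fst (s j)..<snd (s j). P (z i)) \<and> max (fst (s j)) (snd (s j)) \<le> fst (s (Suc j))"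
  proof (rule exE[OF dependent_nat_choice[where P = "\<lambda>_ (s::nat \<times> nat). e \<le> norm (\<Sum>i=fst s..<snd s. P (z i))"
        and Q = "\<lambda>_ s t. max (fst s) (snd s) \<le> fst t"]])
    show "\<exists>s::nat \<times> nat. e \<le> norm (\<Sum>i=fst s..<snd s. P (z i))"
      using e(2)[of 0] by auto
    show "\<exists>t::nat \<times> nat. e \<le> norm (\<Sum>i=fst t..<snd t. P (z i)) \<and> max (fst s) (snd s) \<le> fst t" for s :: "nat \<times> nat"
      using e(2)[of "max (fst s) (snd s)"] by auto
  qed blast
  then obtain s where s: "\<And>j. e \<le> norm (\<Sum>i=fst (s j)..<snd (s j). P (z i))"
    "\<And>j. max (fst (s j)) (snd (s j)) \<le> fst (s (Suc j))" by blast
  define m n where "m j = fst (s j)" and "n j = snd (s j)" for j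
  have mn: "e \<le> norm (\<Sum>i=m j..<n j. P (z i))" "m j \<le> m (Suc j)" "n j \<le> m (Suc j)" for j
    using s[of j] by (simp_all add: m_def n_def)
  \<comment> \<open>With all signs equal to \<open>1\<close>, the \<open>k\<close>-th difference in direction \<open>z i\<close> is \<open>fact k\<close> times \<open>P (z i)\<close>.\<close>
  obtain k' where k': "k = Suc k'" using k by (cases k) auto
  have "\<exists>a. (\<forall>i. \<bar>a i\<bar> \<le> real k) \<and>
      norm (\<Sum>i=m j..<n j. fact k *\<^sub>R P (z i)) \<le> 2 ^ k * norm (P (\<Sum>i=m j..<n j. a i *\<^sub>R z i))" for j
    using sum_diagonal_differences_le[of "{m j..<n j}" k' P "\<lambda>_. 1" z] hom_polys_degree_le[OF E F P]
    by (simp add: hom_polys_funpow_fwd_diff[OF E F P] flip: k')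
  then obtain a where a: "\<And>j i. \<bar>a j i\<bar> \<le> real k"
    and le: "\<And>j. norm (\<Sum>i=m j..<n j. fact k *\<^sub>R P (z i)) \<le> 2 ^ k * norm (P (\<Sum>i=m j..<n j. a j i *\<^sub>R z i))"
    by metis
  define y where "y j = (\<Sum>i=m j..<n j. a j i *\<^sub>R z i)" for j
  have "fact k * e / 2 ^ k \<le> norm (P (y j))" for j
  proof -
    have "fact k * e \<le> norm (\<Sum>i=m j..<n j. fact k *\<^sub>R P (z i))"
      using mn(1)[of j] by (simp flip: scaleR_sum_right)
    then show ?thesis using le[of j] by (simp add: y_def field_simps)
  qed
  moreover have "0 < fact k * e / 2 ^ k" using e by simp
  moreover have "wuC sE y"
    unfolding wuC_def
  proof
    fix f assume f: "f \<in> dual sE"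
    have "summable (\<lambda>i. norm (f (x i)))" using x f by (simp add: wuC_def)
    from summable_reindex[OF this strict_mono_imp_inj_on[OF r]]
    have sm: "summable (\<lambda>i. norm (f (z i)))" by (simp add: z_def o_def)
    have part: "(\<Sum>j<J. norm (f (y j))) \<le> real k * (\<Sum>i<m J. norm (f (z i)))" for J
    proof (induction J)
      case 0
      show ?case by (simp add: sum_nonneg)
    next
      case (Suc J)
      have "norm (f (y J)) \<le> real k * (\<Sum>i=m J..<n J. norm (f (z i)))"
        unfolding y_def by (rule dual_real_combination_bound[OF E f a])
      also have "\<dots> \<le> real k * (\<Sum>i=m J..<m (Suc J). norm (f (z i)))"
        using mn(3)[of J] by (intro mult_left_mono sum_mono2) auto
      finally have "(\<Sum>j<Suc J. norm (f (y j))) \<le>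
        real k * ((\<Sum>i<m J. norm (f (z i))) + (\<Sum>i=m J..<m (Suc J). norm (f (z i))))"
        using Suc by (simp add: algebra_simps)
      also have "(\<Sum>i<m J. norm (f (z i))) + (\<Sum>i=m J..<m (Suc J). norm (f (z i))) = (\<Sum>i<m (Suc J). norm (f (z i)))"
        using mn(2)[of J] sum.atLeastLessThan_concat[of 0 "m J" "m (Suc J)" "\<lambda>i. norm (f (z i))"]
        by (simp add: lessThan_atLeast0)
      finally show ?case .
    qed
    have "(\<Sum>j<J. norm (f (y j))) \<le> real k * (\<Sum>i. norm (f (z i)))" for J
      by (rule order_trans[OF part]) (intro mult_left_mono sum_le_suminf sm; simp)
    then show "summable (\<lambda>j. norm (f (y j)))"
      by (intro summableI_nonneg_bounded) auto
  qed
  ultimately show ?thesis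
    by (intro exI[of _ y] exI[of _ "fact k * e / 2 ^ k"] conjI allI)
qed

lemma unconditionally_convergingI:
  fixes sE :: "'k::real_or_complex \<Rightarrow> 'e::banach \<Rightarrow> 'e" and sF :: "'k \<Rightarrow> 'f::banach \<Rightarrow> 'f"
  assumes "banach_space_over sE" "banach_space_over sF" "k \<ge> 1" "P \<in> hom_polys sE sF k"
    and small: "\<And>y e. wuC sE y \<Longrightarrow> 0 < e \<Longrightarrow> \<exists>n. norm (P (y n)) < e"
  shows "unconditionally_converging sE P"
  unfolding unconditionally_converging_def
proof (intro allI impI, rule ccontr)
  fix x assume "wuC sE x" "\<not> uc (\<lambda>i. P (x i))"
  then obtain y e where "wuC sE y" "0 < e" "\<And>n. e \<le> norm (P (y n))"
    using wuC_with_large_values[OF assms(1-4)] by blast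
  then show False using small[of y e] by (meson not_le)
qed

section \<open>Completely continuous polynomials and Rosenthal sets\<close>

lemma completely_continuous_at_0_small:
  assumes P: "P \<in> hom_polys_cc0 sE sF k" and y: "wuC sE y" and e: "0 < e"
  shows "\<exists>n. norm (P (y n)) < e"
proof -
  have "(\<lambda>n. P (y n)) \<longlonglongrightarrow> 0"
    using P wuC_imp_weakly_null[OF y] by (simp add: hom_polys_cc0_def)
  from tendstoD[OF this e] show ?thesis by (auto simp: eventually_sequentially)
qed

text \<open>A sequence in the range either repeats one value infinitely often or runs through indices tending to
  infinity, in which case it is itself weakly null.\<close>

lemma weakly_null_range_Rosenthal:
  fixes sE :: "'k::real_or_complex \<Rightarrow> 'e::banach \<Rightarrow> 'e"
  assumes y: "weakly_null sE y"
  shows "Rosenthal_set sE (range y)"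
  unfolding Rosenthal_set_def
proof (intro allI impI)
  fix x :: "nat \<Rightarrow> 'e" assume "range x \<subseteq> range y"
  then have "\<forall>i. \<exists>m. x i = y m" by blast
  then obtain m where m: "\<And>i. x i = y (m i)" by metis
  show "\<exists>r. strict_mono r \<and> weakly_Cauchy sE (x \<circ> r)"
  proof (cases "\<exists>j. infinite {i. m i = j}")
    case True
    then obtain j r where "strict_mono (r :: nat \<Rightarrow> nat)" "\<And>n. r n \<in> {i. m i = j}"
      using infinite_enumerate by blast
    then show ?thesis
      by (intro exI[of _ r]) (simp add: weakly_Cauchy_def m o_def LIMSEQ_imp_Cauchy[OF tendsto_const])
  next
    case False
    have m_lim: "filterlim m at_top sequentially"
      unfolding filterlim_at_top
    proof
      fix Z
      have "{i. m i < Z} = (\<Union>j<Z. {i. m i = j})" by auto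
      then have "finite {i. m i < Z}" using False by simp
      then show "\<forall>\<^sub>F i in sequentially. Z \<le> m i"
        by (simp add: eventually_cofinite not_le flip: cofinite_eq_sequentially)
    qed
    have "(\<lambda>i. f (y (m i))) \<longlonglongrightarrow> 0" if "f \<in> dual sE" for f
      using y that by (intro filterlim_compose[OF _ m_lim, where g = "\<lambda>n. f (y n)"]) (simp add: weakly_null_def)
    then have "weakly_Cauchy sE (x \<circ> id)"
      unfolding weakly_Cauchy_def using m by (auto intro: LIMSEQ_imp_Cauchy)
    then show ?thesis using strict_mono_id by blast
  qed
qed

text \<open>If the values stayed away from \<open>0\<close>, a subsequence \<open>P (y (r n))\<close> would have a nonzero limit \<open>z\<close> by
  compactness; a functional that norms \<open>z\<close> then contradicts the vanishing of scalar polynomials along the series.\<close>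

lemma compact_on_Rosenthal_sets_small:
  fixes sE :: "'k::real_or_complex \<Rightarrow> 'e::banach \<Rightarrow> 'e" and sF :: "'k \<Rightarrow> 'f::banach \<Rightarrow> 'f"
  assumes E: "banach_space_over sE" and F: "banach_space_over sF"
    and k: "k \<ge> 1" and P: "P \<in> hom_polys sE sF k"
    and compact: "\<And>A. Rosenthal_set sE A \<Longrightarrow> compact (closure (P ` A))"
    and y: "wuC sE y" and e: "0 < e"
  shows "\<exists>n. norm (P (y n)) < e"
proof (rule ccontr)
  assume "\<not> ?thesis"
  then have large: "e \<le> norm (P (y n))" for n by (simp add: not_less)
  have "compact (closure (P ` range y))"
    by (intro compact weakly_null_range_Rosenthal wuC_imp_weakly_null y)
  then have sc: "seq_compact (closure (P ` range y))" by (rule compact_imp_seq_compact)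
  have inC: "P (y n) \<in> closure (P ` range y)" for n
    by (rule subsetD[OF closure_subset]) simp
  obtain z r where r: "strict_mono r" "((\<lambda>n. P (y n)) \<circ> r) \<longlonglongrightarrow> z"
    using sc[unfolded seq_compact_def, rule_format, of "\<lambda>n. P (y n)"] inC by blast
  have "e \<le> norm z"
    by (rule LIMSEQ_le_const[OF tendsto_norm[OF r(2)]]) (use large in auto)
  obtain g where g: "bounded_linear g" "g z = norm z" using norming_functional[of z] by blast
  have "(\<lambda>n. g (P (0 + y n))) \<longlonglongrightarrow> g (P 0)"
    by (rule hom_polys_functional_tendsto[OF E F k P g(1) wuC_bounded_combinations[OF E y]])
  then have "(\<lambda>n. g (P (y n))) \<longlonglongrightarrow> 0"
    by (simp add: hom_polys_zero[OF E F k P] linear_0[OF bounded_linear.linear[OF g(1)]])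
  from LIMSEQ_subseq_LIMSEQ[OF this r(1)] have "(\<lambda>n. g (P (y (r n)))) \<longlonglongrightarrow> 0" by (simp add: o_def)
  moreover have "(\<lambda>n. g (P (y (r n)))) \<longlonglongrightarrow> g z"
    using bounded_linear.tendsto[OF g(1) r(2)] by (simp add: o_def)
  ultimately have "norm z = 0" using LIMSEQ_unique g(2) by metis
  then show False using \<open>e \<le> norm z\<close> e by simp
qed

section \<open>Dunford--Pettis sets\<close>

lemma sum_geometric_half_le:
  "d \<ge> 0 \<Longrightarrow> (\<Sum>i<N. d / 8 * (1 / 2) ^ i) \<le> (d / 4 :: real)"
proof -
  assume d: "d \<ge> 0"
  have "(\<Sum>i<N. d / 8 * (1 / 2) ^ i) = d / 8 * (\<Sum>i<N. (1 / 2) ^ i)" by (simp add: sum_distrib_left)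
  also have "(\<Sum>i<N. (1 / 2 :: real) ^ i) = 2 - 2 * (1 / 2) ^ N" by (simp add: sum_gp_strict)
  also have "d / 8 * (2 - 2 * (1 / 2) ^ N) \<le> d / 8 * 2" using d by (intro mult_left_mono) auto
  finally show ?thesis by simp
qed

text \<open>The argument behind Schur's theorem, that weakly null sequences of absolutely summable sequences are norm
  null. Large entries of the matrix are picked at rows \<open>n\<close> and columns \<open>m\<close> so that every other
  picked column contributes little to a picked row; the sum of a picked row over the picked columns is then
  close to its large entry, against \<open>lim\<close>.\<close>

lemma sliding_hump_uniform:
  fixes a :: "nat \<Rightarrow> nat \<Rightarrow> 'b::real_normed_vector"
  assumes row: "\<And>n. (\<lambda>m. a n m) \<longlonglongrightarrow> 0" and col: "\<And>m. (\<lambda>n. a n m) \<longlonglongrightarrow> 0"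
    and summable: "\<And>n s. strict_mono s \<Longrightarrow> summable (\<lambda>i. a n (s i))"
    and lim: "\<And>s. strict_mono s \<Longrightarrow> (\<lambda>n. \<Sum>i. a n (s i)) \<longlonglongrightarrow> 0"
    and d: "d > 0"
  shows "\<forall>\<^sub>F n in sequentially. \<forall>m. norm (a n m) < d"
proof (rule ccontr)
  assume "\<not> ?thesis"
  then have freq: "\<exists>\<^sub>F n in sequentially. \<exists>m. d \<le> norm (a n m)"
    by (simp add: frequently_def not_le)
  \<comment> \<open>The errors allowed for the column of index \<open>i\<close> add up to at most \<open>d / 4\<close>.\<close>
  define \<epsilon> where "\<epsilon> i = d / 8 * (1 / 2) ^ i" for i :: nat
  have \<epsilon>: "\<epsilon> i > 0" for i using d by (simp add: \<epsilon>_def)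
  have small: "\<forall>\<^sub>F n in sequentially. norm (b n) \<le> \<epsilon> i" if "b \<longlonglongrightarrow> 0" for b :: "nat \<Rightarrow> 'b" and i
    using tendstoD[OF that \<epsilon>[of i]] by (auto elim: eventually_mono)
  have "\<exists>f. \<forall>j. j \<le> fst (f j) \<and> d \<le> norm (a (fst (f j)) (snd (f j))) \<and> (\<forall>i<j. snd (f i) < snd (f j)
      \<and> norm (a (fst (f j)) (snd (f i))) \<le> \<epsilon> i \<and> norm (a (fst (f i)) (snd (f j))) \<le> \<epsilon> j)"
  proof (rule dependent_wellorder_choice)
    fix j :: nat and f :: "nat \<Rightarrow> nat \<times> nat"
    have "\<forall>\<^sub>F m in sequentially. \<forall>i\<in>{..<j}. snd (f i) < m \<and> norm (a (fst (f i)) m) \<le> \<epsilon> j"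
      by (intro eventually_ball_finite ballI eventually_conj eventually_gt_at_top small row) simp
    then obtain M where M: "\<And>m i. m \<ge> M \<Longrightarrow> i < j \<Longrightarrow> snd (f i) < m \<and> norm (a (fst (f i)) m) \<le> \<epsilon> j"
      unfolding eventually_sequentially by blast
    \<comment> \<open>A late row is small on the columns before \<open>M\<close>, so its large entry lies at or beyond \<open>M\<close>.\<close>
    have "\<forall>\<^sub>F n in sequentially. norm (a n m) < d" for m
      using tendstoD[OF col d] by simp
    then have "\<forall>\<^sub>F n in sequentially. j \<le> n \<and> (\<forall>m\<in>{..<M}. norm (a n m) < d)
        \<and> (\<forall>i\<in>{..<j}. norm (a n (snd (f i))) \<le> \<epsilon> i)"
      by (intro eventually_conj eventually_ball_finite ballI eventually_ge_at_top small col) simp_all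
    from frequently_ex[OF frequently_eventually_frequently[OF freq this]]
    obtain n m where nm: "d \<le> norm (a n m)" "j \<le> n" "\<forall>m\<in>{..<M}. norm (a n m) < d"
      "\<forall>i\<in>{..<j}. norm (a n (snd (f i))) \<le> \<epsilon> i" by blast
    then have "M \<le> m" by (metis lessThan_iff not_le)
    with M nm show "\<exists>r. j \<le> fst r \<and> d \<le> norm (a (fst r) (snd r)) \<and> (\<forall>i<j. snd (f i) < snd r
      \<and> norm (a (fst r) (snd (f i))) \<le> \<epsilon> i \<and> norm (a (fst (f i)) (snd r)) \<le> \<epsilon> j)"
      by (intro exI[of _ "(n, m)"]) auto
  qed simp
  then obtain f where f: "\<And>j. j \<le> fst (f j)" "\<And>j. d \<le> norm (a (fst (f j)) (snd (f j)))"
    "\<And>i j. i < j \<Longrightarrow> snd (f i) < snd (f j)"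
    "\<And>i j. i < j \<Longrightarrow> norm (a (fst (f j)) (snd (f i))) \<le> \<epsilon> i"
    "\<And>i j. i < j \<Longrightarrow> norm (a (fst (f i)) (snd (f j))) \<le> \<epsilon> j" by blast
  define s where "s i = snd (f i)" for i
  have s: "strict_mono s" using f(3) by (simp add: strict_mono_def s_def)
  define S where "S n = (\<Sum>i. a n (s i))" for n
  have "d / 2 \<le> norm (S (fst (f j)))" for j
  proof -
    define v where "v = a (fst (f j)) (s j)"
    define b where "b i = a (fst (f j)) (s i) - (if i = j then v else 0)" for i
    have "norm (b i) \<le> \<epsilon> i" for i
      using f(4)[of i j] f(5)[of j i] less_imp_le[OF \<epsilon>[of i]] by (cases i j rule: linorder_cases) (auto simp: b_def v_def s_def)
    then have "norm (\<Sum>i<N. b i) \<le> (\<Sum>i<N. \<epsilon> i)" for N by (rule order_trans[OF norm_sum sum_mono])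
    also have "(\<Sum>i<N. \<epsilon> i) \<le> d / 4" for N
      unfolding \<epsilon>_def using d by (intro sum_geometric_half_le) simp
    finally have bound: "norm (\<Sum>i<N. b i) \<le> d / 4" for N .
    have "b sums (S (fst (f j)) - v)"
      unfolding b_def S_def using sums_single[of j "\<lambda>_. v"] 
      by (intro sums_diff summable_sums summable s) simp
    then have "(\<lambda>N. norm (\<Sum>i<N. b i)) \<longlonglongrightarrow> norm (S (fst (f j)) - v)"
      unfolding sums_def by (rule tendsto_norm)
    then have "norm (S (fst (f j)) - v) \<le> d / 4" by (rule LIMSEQ_le_const2) (use bound in blast)
    moreover have "d \<le> norm v" using f(2)[of j] by (simp add: v_def s_def)
    ultimately show ?thesis using norm_triangle_sub[of v "S (fst (f j))"] d
      by (simp add: norm_minus_commute)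
  qed
  moreover have "(\<lambda>j. S (fst (f j))) \<longlonglongrightarrow> 0"
    using filterlim_compose[OF lim[OF s] filterlim_at_top_mono[OF filterlim_ident, of "\<lambda>j. fst (f j)"]]
    by (simp add: S_def f(1))
  then have "\<forall>\<^sub>F j in sequentially. norm (S (fst (f j))) < d / 2"
    using tendstoD[of _ 0 sequentially "d / 2"] d by force
  ultimately show False by (auto simp: not_less[symmetric] eventually_sequentially)
qed

text \<open>Summing a functional over any subseries is an element of the bidual. For a weakly null sequence \<open>f n\<close>
  the matrix \<open>f n (y m)\<close> therefore meets the conditions of \<open>sliding_hump_uniform\<close>.\<close>

lemma wuC_Dunford_Pettis:
  fixes sE :: "'k::real_or_complex \<Rightarrow> 'e::banach \<Rightarrow> 'e"
  assumes B: "banach_space_over sE" and y: "wuC sE y"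
  shows "Dunford_Pettis_set sE (insert 0 (range y))"
  unfolding Dunford_Pettis_set_def
proof (intro allI impI)
  fix f assume f: "weakly_null_dual sE f"
  have fd: "f n \<in> dual sE" for n using f by (simp add: weakly_null_dual_def)
  have weak: "(\<lambda>n. \<phi> (f n)) \<longlonglongrightarrow> 0" if "\<phi> \<in> bidual sE" for \<phi>
    using f that by (simp add: weakly_null_dual_def)
  have abs: "summable (\<lambda>i. norm (g (y (s i))))" if "g \<in> dual sE" "strict_mono s" for g s
    using summable_reindex[of "\<lambda>i. norm (g (y i))" s] y that
    by (simp add: wuC_def o_def strict_mono_imp_inj_on)
  have sm: "summable (\<lambda>i. g (y (s i)))" if "g \<in> dual sE" "strict_mono s" for g s
    by (rule real_or_complex_summable_norm_cancel[OF abs[OF that]])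
  have eval: "(\<lambda>g. g (y m)) \<in> bidual sE" for m
    unfolding bidual_def
    using onorm[OF dual_bounded_linear[OF B]] by (auto simp: mult.commute intro!: exI[of _ "norm (y m)"])
  have series: "(\<lambda>g. \<Sum>i. g (y (s i))) \<in> bidual sE" if s: "strict_mono s" for s
  proof -
    obtain C where C: "\<And>B a. finite B \<Longrightarrow> (\<forall>i\<in>B. \<bar>a i\<bar> \<le> 1) \<Longrightarrow> norm (\<Sum>i\<in>B. a i *\<^sub>R y i) \<le> C"
      using wuC_bounded_combinations[OF B y] unfolding bounded_combinations_def by blast
    have "norm (\<Sum>i. g (y (s i))) \<le> C * onorm g" if g: "g \<in> dual sE" for g
    proof (rule LIMSEQ_le_const2)
      show "(\<lambda>N. norm (\<Sum>i<N. g (y (s i)))) \<longlonglongrightarrow> norm (\<Sum>i. g (y (s i)))"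
        by (intro tendsto_norm summable_LIMSEQ sm g s)
      interpret g: bounded_linear g by (rule dual_bounded_linear[OF B g])
      have "norm (\<Sum>i<N. g (y (s i))) \<le> C * onorm g" for N
      proof -
        have "(\<Sum>i<N. y (s i)) = (\<Sum>i\<in>s ` {..<N}. y i)"
          by (subst sum.reindex) (simp_all add: strict_mono_imp_inj_on[OF s])
        then have "norm (\<Sum>i<N. y (s i)) \<le> C" using C[of "s ` {..<N}" "\<lambda>_. 1"] by simp
        then have "onorm g * norm (\<Sum>i<N. y (s i)) \<le> onorm g * C"
          by (intro mult_left_mono onorm_pos_le g.bounded_linear_axioms)
        with onorm[OF g.bounded_linear_axioms, of "\<Sum>i<N. y (s i)"] show ?thesis
          by (simp add: g.sum mult.commute)
      qed
      then show "\<exists>N. \<forall>n\<ge>N. norm (\<Sum>i<n. g (y (s i))) \<le> C * onorm g" by blast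
    qed
    then have "\<exists>C. \<forall>g\<in>dual sE. norm (\<Sum>i. g (y (s i))) \<le> C * onorm g" by blast
    moreover have "(\<Sum>i. g (y (s i)) + h (y (s i))) = (\<Sum>i. g (y (s i))) + (\<Sum>i. h (y (s i)))"
      if "g \<in> dual sE" "h \<in> dual sE" for g h
      by (rule suminf_add[symmetric]; rule sm; rule that s)
    moreover have "(\<Sum>i. c * g (y (s i))) = c * (\<Sum>i. g (y (s i)))" if "g \<in> dual sE" for c g
      by (rule suminf_mult; rule sm; rule that s)
    ultimately show ?thesis
      unfolding bidual_def mem_Collect_eq by (intro conjI ballI allI)
  qed
  have small: "\<forall>\<^sub>F n in sequentially. \<forall>m. norm (f n (y m)) < d" if "d > 0" for d
  proof (rule sliding_hump_uniform[OF _ _ _ _ that])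
    show "(\<lambda>m. f n (y m)) \<longlonglongrightarrow> 0" for n
      using wuC_imp_weakly_null[OF y] fd by (simp add: weakly_null_def)
    show "(\<lambda>n. f n (y m)) \<longlonglongrightarrow> 0" for m using weak[OF eval] .
    show "summable (\<lambda>i. f n (y (s i)))" if "strict_mono s" for n s by (rule sm[OF fd that])
    show "(\<lambda>n. \<Sum>i. f n (y (s i))) \<longlonglongrightarrow> 0" if "strict_mono s" for s using weak[OF series[OF that]] .
  qed
  have f0: "f n 0 = 0" for n using dual_add[OF fd, of n 0 0] by simp
  show "(\<lambda>n. SUP x\<in>insert 0 (range y). ennreal (norm (f n x))) \<longlonglongrightarrow> 0"
  proof (rule order_tendstoI)
    fix a :: ennreal assume "0 < a"
    then obtain c where c: "0 < c" "c < a" using dense by blast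
    define d where "d = enn2real c"
    have cd: "c = ennreal d" using c(2) by (auto simp: d_def top_unique intro!: ennreal_enn2real[symmetric] order_less_le_trans[OF _ top_greatest])
    have "d > 0" using c(1) by (simp add: cd)
    from small[OF this] show "\<forall>\<^sub>F n in sequentially. (SUP x\<in>insert 0 (range y). ennreal (norm (f n x))) < a"
    proof (rule eventually_mono)
      fix n assume n: "\<forall>m. norm (f n (y m)) < d"
      have "(SUP x\<in>insert 0 (range y). ennreal (norm (f n x))) \<le> ennreal d"
        using n \<open>d > 0\<close> by (intro SUP_least) (auto simp: f0 intro!: ennreal_leI less_imp_le)
      also have "\<dots> < a" using c(2) cd by simp
      finally show "(SUP x\<in>insert 0 (range y). ennreal (norm (f n x))) < a" .
    qed
  qed simp
qed

lemma weakly_continuous_on_Dunford_Pettis_sets_small: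
  fixes sE :: "'k::real_or_complex \<Rightarrow> 'e::banach \<Rightarrow> 'e" and sF :: "'k \<Rightarrow> 'f::banach \<Rightarrow> 'f"
  assumes E: "banach_space_over sE" and F: "banach_space_over sF"
    and k: "k \<ge> 1" and P: "P \<in> hom_polys_wd sE sF k"
    and y: "wuC sE y" and e: "0 < e"
  shows "\<exists>n. norm (P (y n)) < e"
proof -
  let ?A = "insert 0 (range y)"
  have Pk: "P \<in> hom_polys sE sF k" using P by (simp add: hom_polys_wd_def)
  have "continuous_map (subtopology (weak_topology sE) ?A) euclidean P"
    using P wuC_Dunford_Pettis[OF E y] by (simp add: hom_polys_wd_def)
  moreover have "limitin (subtopology (weak_topology sE) ?A) y 0 sequentially"
    using weakly_null_limitin[OF E wuC_imp_weakly_null[OF y]] by (simp add: limitin_subtopology)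
  ultimately have "limitin euclidean (P \<circ> y) (P 0) sequentially" by (rule continuous_map_limit)
  then have "(\<lambda>n. P (y n)) \<longlonglongrightarrow> 0" by (simp add: o_def hom_polys_zero[OF E F k Pk])
  from tendstoD[OF this e] show ?thesis by (auto simp: eventually_sequentially)
qed

section \<open>Weakly compact polynomials\<close>

lemma telescope_le:
  fixes s :: "nat \<Rightarrow> real"
  assumes step: "\<And>j. m \<le> j \<Longrightarrow> \<bar>s (Suc j) - s j\<bar> \<le> d / 8 * (1 / 2) ^ j" and d: "d \<ge> 0" and "m \<le> j"
  shows "\<bar>s j - s m\<bar> \<le> d / 4"
proof -
  have "\<bar>s j - s m\<bar> \<le> (\<Sum>i<j. d / 8 * (1 / 2) ^ i)"
    using \<open>m \<le> j\<close>
  proof (induction j rule: dec_induct)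
    case base
    show ?case using d by (simp add: sum_nonneg)
  next
    case (step i)
    have "\<bar>s (Suc i) - s i\<bar> \<le> d / 8 * (1 / 2) ^ i" using step.hyps by (intro assms(1)) simp
    with step.IH show ?case unfolding sum.lessThan_Suc by linarith
  qed
  also have "\<dots> \<le> d / 4" by (rule sum_geometric_half_le[OF d])
  finally show ?thesis .
qed

text \<open>The \<open>k\<close>-th difference of \<open>g \<circ> P\<close> in direction \<open>y\<close> does not depend on the base point \<open>w\<close> and equals
  \<open>fact k\<close> times \<open>g (P y)\<close>; so \<open>g \<circ> P\<close> cannot be nearly constant on \<open>w, w + y, ..., w + k y\<close>. For this
  reason the coefficients in the gliding hump below range over \<open>{0..k}\<close>: with coefficient \<open>1\<close> alone the
  lower-degree terms in \<open>y\<close> might cancel the jump.\<close>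

lemma hom_polys_jump:
  fixes sE :: "'k::real_or_complex \<Rightarrow> 'e::banach \<Rightarrow> 'e" and sF :: "'k \<Rightarrow> 'f::banach \<Rightarrow> 'f"
  assumes E: "banach_space_over sE" and F: "banach_space_over sF"
    and k: "k \<ge> 1" and P: "P \<in> hom_polys sE sF k"
    and g: "linear (g :: 'f \<Rightarrow> real)" and e: "0 < e" "e \<le> g (P y)"
  shows "\<exists>t\<le>k. e / 2 ^ Suc k \<le> \<bar>g (P (w + real t *\<^sub>R y)) - g (P w)\<bar>"
proof (rule ccontr)
  assume "\<not> ?thesis"
  then have small: "\<bar>g (P (w + real t *\<^sub>R y)) - g (P w)\<bar> < e / 2 ^ Suc k" if "t \<le> k" for t
    using that by (meson not_le)
  obtain k' where k': "k = Suc k'" using k by (cases k) auto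
  have const: "(fwd_diff y ^^ k) (\<lambda>_. c) = (\<lambda>_. 0)" for c :: real
    unfolding k' by (rule fwd_diff_funpow_const)
  define \<psi> where "\<psi> v = g (P v) - g (P w)" for v
  have "(fwd_diff y ^^ k) \<psi> w + (fwd_diff y ^^ k) (\<lambda>_. g (P w)) w = (fwd_diff y ^^ k) (\<lambda>v. g (P v)) w"
    using fwd_diff_funpow_add[where h = y and k = k and f = \<psi> and g = "\<lambda>_. g (P w)", THEN fun_cong, of w] by (simp add: \<psi>_def)
  then have "(fwd_diff y ^^ k) \<psi> w = g ((fwd_diff y ^^ k) P w)"
    unfolding const by (simp add: fwd_diff_funpow_compose_additive[OF linear_diff[OF g]])
  also have "\<dots> = fact k * g (P y)"
    by (simp add: hom_polys_funpow_fwd_diff[OF E F P] linear_scale[OF g])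
  finally have eq: "(fwd_diff y ^^ k) \<psi> w = fact k * g (P y)" .
  have "norm ((fwd_diff y ^^ k) \<psi> w) \<le> 2 ^ k * (e / 2 ^ Suc k)"
    by (rule fwd_diff_funpow_le) (use small in \<open>auto simp: \<psi>_def intro: less_imp_le\<close>)
  then have "fact k * g (P y) \<le> e / 2" by (simp add: eq)
  moreover have "1 * g (P y) \<le> fact k * g (P y)" using e by (intro mult_right_mono) auto
  ultimately show False using e by simp
qed

text \<open>The gliding hump described at the beginning. A pair \<open>f j = (n, t)\<close> records that \<open>t y n\<close> is added at stage
  \<open>j\<close>, and \<open>w f j\<close> is the sum of what was added before.\<close>

lemma weakly_compact_polynomial_small:
  fixes sE :: "'k::real_or_complex \<Rightarrow> 'e::banach \<Rightarrow> 'e" and sF :: "'k \<Rightarrow> 'f::banach \<Rightarrow> 'f"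
  assumes E: "banach_space_over sE" and F: "banach_space_over sF"
    and k: "k \<ge> 1" and P: "P \<in> hom_polys_wco sE sF k"
    and y: "bounded_combinations y" and e: "0 < e"
  shows "\<exists>n. norm (P (y n)) < e"
proof (rule ccontr)
  assume "\<not> ?thesis"
  then have large: "e \<le> norm (P (y n))" for n by (simp add: not_less)
  have Pk: "P \<in> hom_polys sE sF k" using P by (simp add: hom_polys_wco_def)
  obtain g where g: "\<And>n. bounded_linear (g n)" "\<And>n v. \<bar>g n v\<bar> \<le> norm v" "\<And>n. g n (P (y n)) = norm (P (y n))"
    using norming_functional[of "P (y _)"] by metis
  have glin: "linear (g n)" for n using g(1) by (rule bounded_linear.linear)
  obtain h where h: "bounded_linear h" "\<And>v. \<bar>h v\<bar> \<le> norm v"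
    and cluster: "\<And>V e. finite V \<Longrightarrow> 0 < e \<Longrightarrow> \<exists>\<^sub>F n in sequentially. \<forall>v\<in>V. \<bar>g n v - h v\<bar> < e"
    using functionals_cluster_point[of g, OF glin g(2)] by blast
  define \<delta> where "\<delta> = e / 2 ^ Suc k"
  have \<delta>: "\<delta> > 0" using e by (simp add: \<delta>_def)
  define \<epsilon> where "\<epsilon> j = \<delta> / 8 * (1 / 2) ^ j" for j :: nat
  have \<epsilon>: "\<epsilon> j > 0" for j using \<delta> by (simp add: \<epsilon>_def)
  define w where "w f j = (\<Sum>i<j. real (snd (f i)) *\<^sub>R y (fst (f i)))" for f :: "nat \<Rightarrow> nat \<times> nat" and j
  have still: "\<forall>\<^sub>F n in sequentially. \<forall>t\<in>{..k}. \<bar>u (P (v + real t *\<^sub>R y n)) - u (P v)\<bar> \<le> \<epsilon> j"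
    if "bounded_linear u" for u :: "'f \<Rightarrow> real" and v j
  proof (intro eventually_ball_finite ballI)
    fix t
    have "(\<lambda>n. u (P (v + real t *\<^sub>R y n))) \<longlonglongrightarrow> u (P v)"
      by (rule hom_polys_functional_tendsto[OF E F k Pk that bounded_combinations_scaleR[OF y]])
    from tendstoD[OF this \<epsilon>[of j]]
    show "\<forall>\<^sub>F n in sequentially. \<bar>u (P (v + real t *\<^sub>R y n)) - u (P v)\<bar> \<le> \<epsilon> j"
      by (rule eventually_mono) (simp add: dist_real_def)
  qed simp
  \<comment> \<open>The new functional \<open>g n\<close> jumps at this stage, the earlier functionals and \<open>h\<close> hardly
    notice it, and on the points reached so far \<open>g n\<close> is close to \<open>h\<close>. These demands are
    compatible: a jump occurs at every \<open>n\<close> for a suitable \<open>t\<close>, closeness to \<open>h\<close> holds frequently,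
    and the other conditions hold for all late \<open>n\<close>.\<close>
  define Q where "Q f j r \<longleftrightarrow> snd r \<le> k \<and> (\<forall>i<j. fst (f i) < fst r)
      \<and> \<delta> \<le> \<bar>g (fst r) (P (w f j + real (snd r) *\<^sub>R y (fst r))) - g (fst r) (P (w f j))\<bar>
      \<and> (\<forall>i<j. \<bar>g (fst (f i)) (P (w f j + real (snd r) *\<^sub>R y (fst r))) - g (fst (f i)) (P (w f j))\<bar> \<le> \<epsilon> j)
      \<and> \<bar>h (P (w f j + real (snd r) *\<^sub>R y (fst r))) - h (P (w f j))\<bar> \<le> \<epsilon> j
      \<and> (\<forall>i\<le>j. \<bar>g (fst r) (P (w f i)) - h (P (w f i))\<bar> \<le> \<epsilon> j)" for f j and r :: "nat \<times> nat"
  have "\<exists>f. \<forall>j. Q f j (f j)"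
  proof (rule dependent_wellorder_choice)
    fix r and f f' :: "nat \<Rightarrow> nat \<times> nat" and j :: nat assume eq: "\<And>i. i < j \<Longrightarrow> f i = f' i"
    have "w f i = w f' i" if "i \<le> j" for i
      unfolding w_def using that eq by (intro sum.cong) auto
    then show "Q f j r = Q f' j r" using eq by (simp add: Q_def cong: conj_cong)
  next
    fix j :: nat and f :: "nat \<Rightarrow> nat \<times> nat"
    have "\<forall>\<^sub>F n in sequentially. (\<forall>i\<in>{..<j}. fst (f i) < n)
      \<and> (\<forall>i\<in>{..<j}. \<forall>t\<in>{..k}. \<bar>g (fst (f i)) (P (w f j + real t *\<^sub>R y n)) - g (fst (f i)) (P (w f j))\<bar> \<le> \<epsilon> j)
      \<and> (\<forall>t\<in>{..k}. \<bar>h (P (w f j + real t *\<^sub>R y n)) - h (P (w f j))\<bar> \<le> \<epsilon> j)"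
      by (intro eventually_conj eventually_ball_finite[OF finite_lessThan] ballI eventually_gt_at_top still g(1) h(1))
    from frequently_ex[OF frequently_eventually_frequently[OF cluster[of "(\<lambda>i. P (w f i)) ` {..j}", OF _ \<epsilon>[of j]] this]]
    obtain n where n: "\<forall>v\<in>(\<lambda>i. P (w f i)) ` {..j}. \<bar>g n v - h v\<bar> < \<epsilon> j" "\<forall>i\<in>{..<j}. fst (f i) < n"
      "\<forall>i\<in>{..<j}. \<forall>t\<in>{..k}. \<bar>g (fst (f i)) (P (w f j + real t *\<^sub>R y n)) - g (fst (f i)) (P (w f j))\<bar> \<le> \<epsilon> j"
      "\<forall>t\<in>{..k}. \<bar>h (P (w f j + real t *\<^sub>R y n)) - h (P (w f j))\<bar> \<le> \<epsilon> j" by auto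
    obtain t where t: "t \<le> k" "\<delta> \<le> \<bar>g n (P (w f j + real t *\<^sub>R y n)) - g n (P (w f j))\<bar>"
      using hom_polys_jump[OF E F k Pk glin[of n] e, of "y n" "w f j"] large[of n] by (auto simp: g(3) \<delta>_def)
    show "\<exists>r. Q f j r"
      unfolding Q_def using n t by (intro exI[of _ "(n, t)"]) (auto intro: less_imp_le)
  qed
  then obtain f where f: "\<And>j. Q f j (f j)" by blast
  define n where "n j = fst (f j)" for j
  define W where "W j = w f j" for j
  have W_Suc: "W (Suc j) = W j + real (snd (f j)) *\<^sub>R y (n j)" for j by (simp add: W_def w_def n_def)
  have t: "snd (f j) \<le> k" for j using f[of j] by (simp add: Q_def)
  have n_less: "n i < n j" if "i < j" for i j using f[of j] that by (simp add: Q_def n_def)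
  have jump: "\<delta> \<le> \<bar>g (n j) (P (W (Suc j))) - g (n j) (P (W j))\<bar>" for j
    using f[of j] by (simp add: Q_def W_Suc) (simp add: W_def n_def)
  have g_step: "\<bar>g (n i) (P (W (Suc j))) - g (n i) (P (W j))\<bar> \<le> \<epsilon> j" if "i < j" for i j
    using f[of j] that by (simp add: Q_def W_Suc) (simp add: W_def n_def)
  have h_step: "\<bar>h (P (W (Suc j))) - h (P (W j))\<bar> \<le> \<epsilon> j" for j
    using f[of j] by (simp add: Q_def W_Suc) (simp add: W_def n_def)
  have gh: "\<bar>g (n j) (P (W i)) - h (P (W i))\<bar> \<le> \<epsilon> j" if "i \<le> j" for i j
    using f[of j] that by (simp add: Q_def W_def n_def)
  have inj: "inj n" using n_less by (intro strict_mono_imp_inj_on) (simp add: strict_mono_def)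
  obtain C where C: "\<And>B a. finite B \<Longrightarrow> (\<forall>i\<in>B. \<bar>a i\<bar> \<le> real k) \<Longrightarrow> norm (\<Sum>i\<in>B. a i *\<^sub>R y i) \<le> C"
    using y unfolding bounded_combinations_def by blast
  have "norm (W j) \<le> C" for j
  proof -
    have "W j = (\<Sum>m\<in>n ` {..<j}. real (snd (f (inv n m))) *\<^sub>R y m)"
      by (simp add: sum.reindex inj_on_subset[OF inj subset_UNIV] inv_f_f[OF inj] W_def w_def flip: n_def)
    then show ?thesis using C[of "n ` {..<j}" "\<lambda>m. real (snd (f (inv n m)))"] t by simp
  qed
  then have "range (\<lambda>j. P (W j)) \<subseteq> P ` cball 0 C" by auto
  moreover have "rel_weakly_compact sF (P ` cball 0 C)" using P by (simp add: hom_polys_wco_def)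
  ultimately have "\<exists>z. \<forall>u c e. bounded_linear (u :: 'f \<Rightarrow> real) \<longrightarrow>
      (\<forall>\<^sub>F j in sequentially. \<bar>u (P (W j)) - c\<bar> \<le> e) \<longrightarrow> \<bar>u z - c\<bar> \<le> e"
    by (intro weakly_compact_cluster_point[OF F])
  then obtain z where z: "\<And>u c e. bounded_linear (u :: 'f \<Rightarrow> real) \<Longrightarrow>
      (\<forall>\<^sub>F j in sequentially. \<bar>u (P (W j)) - c\<bar> \<le> e) \<Longrightarrow> \<bar>u z - c\<bar> \<le> e"
    by blast
  \<comment> \<open>Of the jump \<open>\<delta>\<close>, later stages remove at most \<open>\<delta> / 4\<close> for \<open>g (n i)\<close> and \<open>\<delta> / 4\<close> for
    \<open>h\<close>, and the distance of the two functionals at \<open>P (W i)\<close> at most \<open>\<delta> / 8\<close>.\<close>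
  have far: "3 * \<delta> / 8 \<le> \<bar>g (n i) z - h z\<bar>" for i
  proof -
    have "\<bar>g (n i) (P (W j)) - g (n i) (P (W (Suc i)))\<bar> \<le> \<delta> / 4" if "j \<ge> Suc i" for j
      using telescope_le[of "Suc i" "\<lambda>j. g (n i) (P (W j))" \<delta> j] g_step[of i] \<delta> that by (simp add: \<epsilon>_def)
    then have "\<bar>g (n i) z - g (n i) (P (W (Suc i)))\<bar> \<le> \<delta> / 4"
      by (intro z g(1)) (auto simp: eventually_sequentially)
    moreover have "\<bar>h (P (W j)) - h (P (W i))\<bar> \<le> \<delta> / 4" if "j \<ge> i" for j
      using telescope_le[of i "\<lambda>j. h (P (W j))" \<delta> j] h_step \<delta> that by (simp add: \<epsilon>_def)
    then have "\<bar>h z - h (P (W i))\<bar> \<le> \<delta> / 4"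
      by (intro z h(1)) (auto simp: eventually_sequentially)
    moreover have "\<epsilon> i \<le> \<delta> / 8 * 1"
      unfolding \<epsilon>_def using \<delta> by (intro mult_left_mono power_le_one) auto
    then have "\<bar>g (n i) (P (W i)) - h (P (W i))\<bar> \<le> \<delta> / 8" using gh[of i i] by simp
    ultimately show ?thesis using jump[of i] by linarith
  qed
  \<comment> \<open>On the closed span of the \<open>P (W j)\<close> the gap must close; the three errors of \<open>\<delta> / 16\<close> below stay under \<open>3 \<delta> / 8\<close>.\<close>
  have lim: "(\<lambda>i. g (n i) s) \<longlonglongrightarrow> h s" if "s \<in> span (range (\<lambda>j. P (W j)))" for s
    using that
  proof (induction rule: span_induct_alt)
    case base
    show ?case by (simp add: linear_0[OF glin] linear_0[OF bounded_linear.linear[OF h(1)]])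
  next
    case (step c x s)
    then obtain j where x: "x = P (W j)" by blast
    have "(\<lambda>i. \<epsilon> i) \<longlonglongrightarrow> \<delta> / 8 * 0"
      unfolding \<epsilon>_def by (intro tendsto_mult_left LIMSEQ_realpow_zero) auto
    then have "(\<lambda>i. \<epsilon> i) \<longlonglongrightarrow> 0" by simp
    then have "(\<lambda>i. g (n i) x - h x) \<longlonglongrightarrow> 0"
      by (rule Lim_null_comparison[rotated]) (use gh x in \<open>auto simp: eventually_sequentially\<close>)
    then have "(\<lambda>i. c * g (n i) x + g (n i) s) \<longlonglongrightarrow> c * h x + h s"
      using step by (intro tendsto_intros) (simp_all add: LIM_zero_iff)
    then show ?case
      by (simp add: linear_add[OF glin] linear_scale[OF glin]
          linear_add[OF bounded_linear.linear[OF h(1)]] linear_scale[OF bounded_linear.linear[OF h(1)]])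
  qed
  have "z \<in> closure (span (range (\<lambda>j. P (W j))))"
  proof (rule ccontr)
    assume "z \<notin> closure (span (range (\<lambda>j. P (W j))))"
    from separate_point_closed_subspace[OF subspace_span this]
    obtain u :: "'f \<Rightarrow> real" where u: "bounded_linear u" "\<And>v. v \<in> span (range (\<lambda>j. P (W j))) \<Longrightarrow> u v = 0" "u z \<noteq> 0"
      by blast
    have "\<bar>u z - 0\<bar> \<le> 0" by (rule z[OF u(1)]) (simp add: u(2) span_base)
    then show False using u(3) by simp
  qed
  then obtain s where s: "s \<in> span (range (\<lambda>j. P (W j)))" "dist s z < \<delta> / 16"
    using \<delta> unfolding closure_approachable by (metis divide_pos_pos zero_less_numeral)
  have hs: "\<bar>h (s - z)\<bar> \<le> \<delta> / 16" using h(2)[of "s - z"] s(2) by (simp add: dist_norm)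
  obtain i where i: "\<bar>g (n i) s - h s\<bar> < \<delta> / 16"
    using tendstoD[OF lim[OF s(1)], of "\<delta> / 16"] \<delta> by (auto simp: dist_real_def eventually_sequentially)
  have "\<bar>g (n i) (s - z)\<bar> \<le> \<delta> / 16" using g(2)[of "n i" "s - z"] s(2) by (simp add: dist_norm)
  then show False
    using far[of i] i hs \<delta> linear_diff[OF glin[of "n i"], of s z] linear_diff[OF bounded_linear.linear[OF h(1)], of s z] by linarith
qed

theorem proposition5:
  fixes sE :: "'k::real_or_complex \<Rightarrow> 'e::banach \<Rightarrow> 'e"
    and sF :: "'k \<Rightarrow> 'f::banach \<Rightarrow> 'f"
    and k :: nat
    and P :: "'e \<Rightarrow> 'f"
  assumes "banach_space_over sE" and "banach_space_over sF"
    and "k \<ge> 1"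
    and "P \<in> hom_polys sE sF k"
  shows "(P \<in> hom_polys_cc0 sE sF k \<longrightarrow> unconditionally_converging sE P) \<and>
         ((\<forall>A. Rosenthal_set sE A \<longrightarrow> compact (closure (P ` A))) \<longrightarrow> unconditionally_converging sE P) \<and>
         (P \<in> hom_polys_wd sE sF k \<longrightarrow> unconditionally_converging sE P) \<and>
         (P \<in> hom_polys_wco sE sF k \<longrightarrow> unconditionally_converging sE P)"
proof (intro conjI impI)
  note reduce = unconditionally_convergingI[OF assms]
  show "unconditionally_converging sE P" if "P \<in> hom_polys_cc0 sE sF k"
    using completely_continuous_at_0_small[OF that] by (rule reduce)
  show "unconditionally_converging sE P" if "\<forall>A. Rosenthal_set sE A \<longrightarrow> compact (closure (P ` A))"
    by (rule reduce, rule compact_on_Rosenthal_sets_small[OF assms]) (use that in auto)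
  show "unconditionally_converging sE P" if "P \<in> hom_polys_wd sE sF k"
    using weakly_continuous_on_Dunford_Pettis_sets_small[OF assms(1-3) that] by (rule reduce)
  show "unconditionally_converging sE P" if "P \<in> hom_polys_wco sE sF k"
    using weakly_compact_polynomial_small[OF assms(1-3) that] wuC_bounded_combinations[OF assms(1)]
    by (intro reduce) blast
qed

end
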